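(* Let $d > v\geq 0$ and $m\geq 1$ be integers, let $w:=m(d-v)-1$ and assume $d>w$, and let $D:=(d-v)(d-w)$. Suppose that $\mu_1,\ldots,\mu_m$ are $m$ probability measures on $\mathbb{R}P^d$ and $V\subset\mathbb{R}P^d$ is a projective subspace of dimension $v$. Then there exists a projective subspace $W\subset\mathbb{R}P^d$ of dimension $w$ such that any pair of hyperplanes $H_1\supseteq V$ and $H_2\supseteq W$ partitions $\mathbb{R}P^d$ into two closed parts $P_1$ and $P_2$ so that for any $j\in\{1,\ldots,m\}$, $$ \mu_j(P_1),\ \mu_j(P_2)\ \geq\ \frac{1}{D+1}. $$
   Context: Measures are Borel measures. Hyperplanes are projective hyperplanes of $\mathbb{R}P^d$. Any two distinct hyperplanes $H_1$ and $H_2$ partition $\mathbb{R}P^d$ into two parts, which are always taken to be closed (i.e. the closures of the two connected components of $\mathbb{R}P^d\setminus(H_1\cup H_2)$). If $H_1=H_2$, then by convention the two parts are $H_1=H_2$ itself and the whole space $\mathbb{R}P^d$. *)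

theory Defs
  imports "HOL-Probability.Probability"
begin

(* Real projective space of dimension CARD('n) - 1, as the set of lines through 0. *)
typedef 'n rproj = "{L :: (real ^ 'n::finite) set. subspace L \<and> dim L = 1}"
  morphisms line_of Abs_rproj
proof -
  have "axis undefined 1 \<noteq> (0 :: real ^ 'n)"
    by (simp add: axis_eq_0_iff)
  then have "subspace (span {axis undefined 1 :: real ^ 'n}) \<and> dim (span {axis undefined 1 :: real ^ 'n}) = 1"
    by (simp add: dim_span)
  then show ?thesis by blast
qed

lemma subspace_line_of: "subspace (line_of p)"
  and dim_line_of: "dim (line_of p) = 1"
  using line_of[of p] by auto

lemma line_of_eq_span:
  assumes "x \<in> line_of p" "x \<noteq> 0"
  shows "line_of p = span {x}"
proof -
  have "span {x} \<subseteq> line_of p"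
    using assms subspace_line_of[of p] by (intro span_minimal) auto
  moreover have "dim (line_of p) \<le> dim (span {x})"
    using assms by (simp add: dim_line_of dim_span)
  ultimately show ?thesis
    by (metis subspace_dim_equal subspace_line_of subspace_span)
qed

lemma line_of_unique:
  assumes "x \<in> line_of p" "x \<in> line_of q" "x \<noteq> 0"
  shows "p = q"
  using assms by (metis line_of_eq_span line_of_inject)

lemma ex_line_of:
  assumes "x \<noteq> 0"
  shows "\<exists>p. x \<in> line_of p"
proof -
  have "span {x} \<in> {L. subspace L \<and> dim L = 1}"
    using assms by (simp add: dim_span)
  then show ?thesis
    by (metis Abs_rproj_inverse span_base singletonI)
qed

(* The quotient topology: the set below is the preimage of U under the map
   sending a nonzero vector to the line it spans. *)
instantiation rproj :: (finite) topological_space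
begin

definition open_rproj :: "'a rproj set \<Rightarrow> bool"
  where "open_rproj U \<longleftrightarrow> open {x. x \<noteq> 0 \<and> (\<exists>p\<in>U. x \<in> line_of p)}"

instance
proof
  have "{x. x \<noteq> 0 \<and> (\<exists>p\<in>UNIV. x \<in> line_of p)} = - {0 :: real ^ 'a}"
    using ex_line_of by auto
  then show "open (UNIV :: 'a rproj set)"
    by (simp add: open_rproj_def open_Compl)
next
  fix S T :: "'a rproj set"
  assume "open S" "open T"
  moreover have "{x. x \<noteq> 0 \<and> (\<exists>p\<in>S \<inter> T. x \<in> line_of p)} =
      {x. x \<noteq> 0 \<and> (\<exists>p\<in>S. x \<in> line_of p)} \<inter> {x. x \<noteq> 0 \<and> (\<exists>p\<in>T. x \<in> line_of p)}"
    using line_of_unique by blast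
  ultimately show "open (S \<inter> T)"
    by (simp add: open_rproj_def open_Int)
next
  fix K :: "'a rproj set set"
  assume K: "\<forall>S\<in>K. open S"
  have "{x. x \<noteq> 0 \<and> (\<exists>p\<in>\<Union>K. x \<in> line_of p)} =
      (\<Union>S\<in>K. {x. x \<noteq> 0 \<and> (\<exists>p\<in>S. x \<in> line_of p)})"
    by blast
  then show "open (\<Union>K)"
    using K by (simp add: open_rproj_def open_UN)
qed

end

definition projective_subspace :: "nat \<Rightarrow> 'n::finite rproj set \<Rightarrow> bool"
  where "projective_subspace k P \<longleftrightarrow>
    (\<exists>S. subspace S \<and> dim S = k + 1 \<and> P = {p. line_of p \<subseteq> S})"

(* Meant for projective hyperplanes H1 and H2; the case H1 = H2 is a convention. *)
definition hyperplane_parts :: "'n::finite rproj set \<Rightarrow> 'n rproj set \<Rightarrow> 'n rproj set set"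
  where "hyperplane_parts H1 H2 =
    (if H1 = H2 then {H1, UNIV} else closure ` components (UNIV - (H1 \<union> H2)))"

end

theory Submission
  imports Defs "HOL-Library.Z2"
begin

text \<open>Write everything in the linear space of dimension \<open>d + 1\<close>, where the given subspace has codimension
\<open>k = d - v\<close> and the subspace sought has codimension \<open>n = d - w\<close>, so that \<open>d + 1 = m k + n\<close>. A hyperplane
through the given subspace is the kernel of a functional \<open>l\<close> from a fixed \<open>k\<close>-dimensional space, a
hyperplane through the sought one is the kernel of a functional \<open>\<eta>\<close> from an \<open>n\<close>-dimensional space
\<open>U\<close> that can be chosen freely, and the two parts are \<open>{l \<eta> \<ge> 0}\<close> and \<open>{l \<eta> \<le> 0}\<close>; this also covers
the convention for equal hyperplanes. If the rows of \<open>\<Lambda>\<close> span the space of the functionals \<open>l\<close> and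
the rows of \<open>A\<close> span \<open>U\<close>, then \<open>l \<eta>\<close> is a linear function of the
\<open>k \<times> n\<close> matrix \<open>x \<mapsto> \<Lambda>x \<otimes> Ax\<close>. Hence it suffices to find an orthogonal \<open>n\<close>-frame \<open>A\<close> for which
\<open>0\<close> is a center point, in the \<open>D = k n\<close> dimensional space of matrices, of the distribution of
\<open>\<Lambda>x \<otimes> Ax\<close> under each of the \<open>m\<close> measures: every closed half-space with \<open>0\<close> on its boundary has
mass at least \<open>1 / (D + 1)\<close>.

For a fixed frame, call a direction bad if its half-space is too light. By Caratheodory's theorem
\<open>0\<close> is not in the convex hull of the bad directions, for otherwise at most \<open>D + 1\<close> light half-spaces
would cover the whole space (\<open>weighted_center\<close>). So a sum of the bad directions, weighted by a
continuous measure of their badness, vanishes only if there are no bad directions. These sums, one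
for each measure, are continuous functions of \<open>A\<close>, and changing the sign of a row of \<open>A\<close> changes the
sign of the corresponding column. Their entries and the orthogonality relations between the rows
form a system of \<open>n m k + n (n - 1) / 2\<close> equations that is odd with respect to the sign changes of
the rows.

Such a system is solved by a Borsuk--Ulam theorem for products of spheres, if row \<open>i\<close> is taken from
a sphere of dimension \<open>m k + i\<close> (\<open>Stiefel_common_zero\<close>). In cohomology, the obstruction to a
common zero on a product of projective spaces is the product of the characters of the equations,
here \<open>(\<Prod>i. t\<^sub>i ^ (m k)) * (\<Prod>i<j. t\<^sub>i + t\<^sub>j)\<close> modulo two, in which the top monomial has coefficient
one because the second factor is a Vandermonde determinant. The proof below makes this argument
elementary. The sign of each function is a mod-two cochain whose coboundary is supported on the edges
along which the function changes sign. The cup product of these coboundaries, evaluated on a fine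
triangulation of a product of hemispheres, is computed by Stokes' theorem: the boundary of a hemisphere
is a hemisphere of lower dimension together with its antipode, and on this pair a cochain of odd
character contributes one (\<open>crossings_Cons\<close>). As the value is one, some small simplex carries a sign
change of every function, and compactness turns this into a common zero.\<close>

section \<open>Cup products on lattice cubes\<close>

text \<open>As rewrite rules these facts turn ring operations into bit operations, so that sums and products can
no longer be distributed.\<close>

declare add_bit_eq_xor [simp del] mult_bit_eq_and [simp del]

lemma bit_add_self [simp]: "x + x = (0::bit)"
  by (cases x) auto

lemma bit_add_eq_0_iff: "x + y = 0 \<longleftrightarrow> x = (y::bit)"
  by (cases x; cases y) auto

lemma sum_bit_involution:
  fixes h :: "'a \<Rightarrow> bit"
  assumes "finite S"
    and "\<And>x. x \<in> S \<Longrightarrow> \<phi> x \<in> S \<and> \<phi> (\<phi> x) = x \<and> \<phi> x \<noteq> x \<and> h (\<phi> x) = h x"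
  shows "sum h S = 0"
  using assms
proof (induction "card S" arbitrary: S rule: less_induct)
  case less
  show ?case
  proof (cases "S = {}")
    case False
    then obtain x where x: "x \<in> S" by blast
    let ?S' = "S - {x, \<phi> x}"
    have "?S' \<subset> S"
      using x by blast
    then have "card ?S' < card S"
      using less.prems(1) by (rule psubset_card_mono[rotated])
    moreover have "\<phi> y \<in> ?S' \<and> \<phi> (\<phi> y) = y \<and> \<phi> y \<noteq> y \<and> h (\<phi> y) = h y" if "y \<in> ?S'" for y
      using that less.prems(2)[of y] less.prems(2)[OF x] by auto
    ultimately have "sum h ?S' = 0"
      using less.hyps[of ?S'] less.prems(1) by blast
    moreover have "S = insert x (insert (\<phi> x) ?S')"
      using x less.prems(2)[OF x] by blast
    then have "sum h S = h x + (h (\<phi> x) + sum h ?S')"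
      using less.prems(1) less.prems(2)[OF x]
      by (metis (no_types, lifting) Diff_iff finite_Diff insertCI insertE sum.insert finite_insert)
    ultimately show ?thesis
      using less.prems(2)[OF x] by simp
  qed simp
qed

lemma sum_bit_symmetric:
  fixes f :: "'a \<Rightarrow> 'a \<Rightarrow> bit"
  assumes "finite I" and "\<And>i j. f i j = f j i"
  shows "(\<Sum>i\<in>I. \<Sum>j\<in>I - {i}. f i j) = 0"
proof -
  have "(\<Sum>i\<in>I. \<Sum>j\<in>I - {i}. f i j) = (\<Sum>(i, j)\<in>(SIGMA i:I. I - {i}). f i j)"
    using assms(1) by (subst sum.Sigma) auto
  also have "\<dots> = 0"
    using assms by (intro sum_bit_involution[where \<phi> = prod.swap]) auto
  finally show ?thesis .
qed

definition step :: "'c \<Rightarrow> ('c \<Rightarrow> nat) \<Rightarrow> 'c \<Rightarrow> nat" where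
  "step i v = v(i := Suc (v i))"

lemma step_commute: "step i (step j v) = step j (step i v)"
  by (auto simp: step_def)

text \<open>The value of the cup product \<open>\<delta>s\<^sub>1 \<union> \<dots> \<union> \<delta>s\<^sub>r\<close>, modulo two, summed over all lattice paths that start at
\<open>v\<close> and take \<open>r\<close> unit steps in distinct directions from \<open>I\<close>. If \<open>r\<close> is the number of directions,
these paths are the simplices of the standard triangulation of the unit cube with lowest corner \<open>v\<close>.\<close>

fun path_sum :: "(('c \<Rightarrow> nat) \<Rightarrow> bit) list \<Rightarrow> 'c set \<Rightarrow> ('c \<Rightarrow> nat) \<Rightarrow> bit" where
  "path_sum [] I v = 1"
| "path_sum (s # ss) I v =
    (\<Sum>i\<in>I. (s v + s (step i v)) * path_sum ss (I - {i}) (step i v))"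

text \<open>A cup product of coboundaries is a cocycle: its sums over the upper and over the lower facets of the unit cube with
lowest corner \<open>v\<close> agree. In the induction, the terms that are symmetric in two directions
cancel modulo two.\<close>

lemma path_sum_closed:
  assumes "finite I" and "card I = Suc (length ss)"
  shows "(\<Sum>i\<in>I. path_sum ss (I - {i}) (step i v)) = (\<Sum>i\<in>I. path_sum ss (I - {i}) v)"
  using assms
proof (induction ss arbitrary: I v)
  case Nil
  then show ?case by simp
next
  case (Cons s ss)
  let ?P = "\<lambda>i j. path_sum ss (I - {i} - {j})"
  have swap: "?P i j = ?P j i" for i j
    by (metis Diff_insert2 Diff_insert)
  have IH: "(\<Sum>j\<in>I-{i}. ?P i j (step j u)) = (\<Sum>j\<in>I-{i}. ?P i j u)" if "i \<in> I" for i u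
    using Cons.IH[of "I - {i}" u] Cons.prems that by simp
  have "(\<Sum>i\<in>I. path_sum (s # ss) (I - {i}) (step i v))
      = (\<Sum>i\<in>I. \<Sum>j\<in>I-{i}. s (step i v) * ?P i j (step j (step i v)))
        + (\<Sum>i\<in>I. \<Sum>j\<in>I-{i}. s (step j (step i v)) * ?P i j (step j (step i v)))"
    by (simp only: path_sum.simps distrib_right sum.distrib)
  also have "(\<Sum>i\<in>I. \<Sum>j\<in>I-{i}. s (step j (step i v)) * ?P i j (step j (step i v))) = 0"
    using Cons.prems by (intro sum_bit_symmetric) (auto simp only: swap step_commute)
  also have "(\<Sum>i\<in>I. \<Sum>j\<in>I-{i}. s (step i v) * ?P i j (step j (step i v)))
      = (\<Sum>i\<in>I. \<Sum>j\<in>I-{i}. s (step i v) * ?P i j (step i v))"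
    by (rule sum.cong[OF refl]) (simp only: sum_distrib_left[symmetric] IH)
  also have "\<dots> = (\<Sum>j\<in>I. \<Sum>i\<in>I-{j}. s (step i v) * ?P i j (step i v))"
    using Cons.prems
    by (subst (1 2) sum.Sigma)
      (auto intro!: sum.reindex_bij_witness[where i = prod.swap and j = prod.swap])
  also have "\<dots> = (\<Sum>j\<in>I. \<Sum>i\<in>I-{j}. s (step i v) * ?P j i (step i v))"
    using swap by (intro sum.cong refl) metis
  finally have L: "(\<Sum>i\<in>I. path_sum (s # ss) (I - {i}) (step i v))
      = (\<Sum>j\<in>I. \<Sum>i\<in>I-{j}. s (step i v) * ?P j i (step i v))" by simp
  have "(\<Sum>i\<in>I. path_sum (s # ss) (I - {i}) v)
      = (\<Sum>i\<in>I. \<Sum>j\<in>I-{i}. s v * ?P i j (step j v))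
        + (\<Sum>i\<in>I. \<Sum>j\<in>I-{i}. s (step j v) * ?P i j (step j v))"
    by (simp only: path_sum.simps distrib_right sum.distrib)
  also have "(\<Sum>i\<in>I. \<Sum>j\<in>I-{i}. s v * ?P i j (step j v)) = (\<Sum>i\<in>I. \<Sum>j\<in>I-{i}. s v * ?P i j v)"
    by (rule sum.cong[OF refl]) (simp only: sum_distrib_left[symmetric] IH)
  also have "\<dots> = 0"
    using Cons.prems by (intro sum_bit_symmetric) (auto simp only: swap)
  finally show ?case
    using L by simp
qed

definition grid :: "nat \<Rightarrow> 'c set \<Rightarrow> ('c \<Rightarrow> nat) set" where
  "grid L I = PiE I (\<lambda>_. {..<L})"

lemma finite_grid [simp]: "finite I \<Longrightarrow> finite (grid L I)"
  by (simp add: grid_def finite_PiE)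

lemma sum_grid_remove:
  assumes "i \<in> I"
  shows "(\<Sum>v\<in>grid L I. f v) = (\<Sum>v\<in>grid L (I - {i}). \<Sum>y<L. f (v(i := y)))"
proof -
  have I: "insert i (I - {i}) = I"
    using assms by auto
  have "grid L I = (\<lambda>(y, g). g(i := y)) ` ({..<L} \<times> grid L (I - {i}))"
    unfolding grid_def using PiE_insert_eq[of i "I - {i}" "\<lambda>_. {..<L}"] I by simp
  then have "(\<Sum>v\<in>grid L I. f v) = (\<Sum>(y, g)\<in>{..<L} \<times> grid L (I - {i}). f (g(i := y)))"
    using inj_combinator[of i "I - {i}" "\<lambda>_. {..<L}"]
    by (simp add: sum.reindex grid_def case_prod_unfold)
  also have "\<dots> = (\<Sum>y<L. \<Sum>v\<in>grid L (I - {i}). f (v(i := y)))"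
    by (simp add: sum.cartesian_product)
  finally show ?thesis
    by (subst sum.swap)
qed

lemma sum_bit_telescope: "(\<Sum>y<L. f (Suc y) + f y) = f L + (f 0 :: bit)"
proof -
  have "(\<Sum>y<L. f (Suc y) - f y) = f L - f 0"
    by (rule sum_lessThan_telescope)
  then show ?thesis
    by simp
qed

text \<open>Since \<open>\<omega> = \<delta>s\<^sub>2 \<union> \<dots> \<union> \<delta>s\<^sub>r\<close> is closed, \<open>\<delta>s\<^sub>1 \<union> \<omega>\<close> is the coboundary of \<open>s\<^sub>1 \<union> \<omega>\<close>, and its sum
over a large cube telescopes to the facets of that cube.\<close>

lemma path_sum_Stokes:
  assumes "finite I" and "card I = Suc (length ss)"
  shows "(\<Sum>v\<in>grid L I. path_sum (s # ss) I v) =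
    (\<Sum>i\<in>I. \<Sum>v\<in>grid L (I - {i}). \<Sum>b\<in>{True, False}.
       s (v(i := if b then L else 0)) * path_sum ss (I - {i}) (v(i := if b then L else 0)))"
proof -
  let ?h = "\<lambda>i v. s v * path_sum ss (I - {i}) v"
  have "path_sum (s # ss) I v = (\<Sum>i\<in>I. ?h i (step i v) + ?h i v)" for v
  proof -
    have "path_sum (s # ss) I v = (\<Sum>i\<in>I. ?h i (step i v)) + s v * (\<Sum>i\<in>I. path_sum ss (I - {i}) (step i v))"
      by (simp add: distrib_right sum.distrib sum_distrib_left add.commute)
    also have "(\<Sum>i\<in>I. path_sum ss (I - {i}) (step i v)) = (\<Sum>i\<in>I. path_sum ss (I - {i}) v)"
      by (rule path_sum_closed[OF assms])
    finally show ?thesis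
      by (simp add: sum.distrib sum_distrib_left)
  qed
  then have "(\<Sum>v\<in>grid L I. path_sum (s # ss) I v) = (\<Sum>i\<in>I. \<Sum>v\<in>grid L I. ?h i (step i v) + ?h i v)"
    by (simp only:) (rule sum.swap)
  also have "\<dots> = (\<Sum>i\<in>I. \<Sum>v\<in>grid L (I - {i}). ?h i (v(i := L)) + ?h i (v(i := 0)))"
  proof (rule sum.cong[OF refl])
    fix i assume "i \<in> I"
    then have "(\<Sum>v\<in>grid L I. ?h i (step i v) + ?h i v)
      = (\<Sum>v\<in>grid L (I - {i}). \<Sum>y<L. ?h i (v(i := Suc y)) + ?h i (v(i := y)))"
      by (subst sum_grid_remove) (auto simp: step_def)
    also have "\<dots> = (\<Sum>v\<in>grid L (I - {i}). ?h i (v(i := L)) + ?h i (v(i := 0)))"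
      by (rule sum.cong[OF refl], rule sum_bit_telescope)
    finally show "(\<Sum>v\<in>grid L I. ?h i (step i v) + ?h i v) = \<dots>" .
  qed
  finally show ?thesis
    by simp
qed

text \<open>Only differences of values of a cochain enter, so a cochain may be changed by a constant. This
makes path sums invariant under sign changes of the rows.\<close>

lemma path_sum_cong:
  assumes "\<And>s. s \<in> set ss \<Longrightarrow> \<exists>b. \<forall>v'. (\<forall>c. c \<notin> I \<longrightarrow> v' c = v c) \<longrightarrow> g s v' = f s v' + b"
  shows "path_sum (map g ss) I v = path_sum (map f ss) I v"
  using assms
proof (induction ss arbitrary: I v)
  case (Cons s ss)
  obtain b where b: "\<And>v'. (\<forall>c. c \<notin> I \<longrightarrow> v' c = v c) \<Longrightarrow> g s v' = f s v' + b"
    using Cons.prems[of s] by auto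
  have "path_sum (map g ss) (I - {i}) (step i v) = path_sum (map f ss) (I - {i}) (step i v)"
    if "i \<in> I" for i
  proof (rule Cons.IH)
    fix s' assume "s' \<in> set ss"
    then obtain b' where b': "\<And>v'. (\<forall>c. c \<notin> I \<longrightarrow> v' c = v c) \<Longrightarrow> g s' v' = f s' v' + b'"
      using Cons.prems[of s'] by auto
    have "g s' v' = f s' v' + b'" if "\<forall>c. c \<notin> I - {i} \<longrightarrow> v' c = step i v c" for v'
    proof (rule b', intro allI impI)
      fix c assume "c \<notin> I"
      then show "v' c = v c"
        using that \<open>i \<in> I\<close> by (auto simp: step_def)
    qed
    then show "\<exists>b. \<forall>v'. (\<forall>c. c \<notin> I - {i} \<longrightarrow> v' c = step i v c) \<longrightarrow> g s' v' = f s' v' + b"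
      by blast
  qed
  moreover have "g s v + g s (step i v) = f s v + f s (step i v)" if "i \<in> I" for i
  proof -
    have "g s v = f s v + b"
      by (intro b) auto
    moreover have "g s (step i v) = f s (step i v) + b"
      using that by (intro b) (auto simp: step_def)
    ultimately show ?thesis
      by (cases b; cases "f s v"; cases "f s (step i v)") auto
  qed
  ultimately show ?case
    by simp
qed simp

lemma path_sum_independent:
  assumes "c \<notin> I" and "\<And>s v'. s \<in> set ss \<Longrightarrow> s (v'(c := b)) = s v'"
  shows "path_sum ss I (v(c := b)) = path_sum ss I v"
  using assms
proof (induction ss arbitrary: I v)
  case (Cons s ss)
  have "step i (v(c := b)) = (step i v)(c := b)" if "i \<in> I" for i
    using that Cons.prems(1) by (auto simp: step_def)
  moreover have "path_sum ss (I - {i}) ((step i v)(c := b)) = path_sum ss (I - {i}) (step i v)" for i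
    using Cons.prems by (intro Cons.IH) auto
  moreover have "s (v'(c := b)) = s v'" for v'
    by (rule Cons.prems(2)) simp
  ultimately show ?case
    by (simp only: path_sum.simps cong: sum.cong)
qed (simp only: path_sum.simps)

section \<open>Hemispheres of the cross-polytope\<close>

text \<open>A point on the unit sphere of the \<open>\<ell>\<^sup>1\<close>-norm, which is the boundary of the cross-polytope, obtained
by iterated coning: stage \<open>k\<close> moves from plus or minus the previous point towards the next unit
vector. For a fixed choice of the signs \<open>e\<close>, the cube of the parameters \<open>u\<close> is mapped onto one facet of a
hemisphere of dimension \<open>k\<close>, and the sum over all signs represents the whole hemisphere. This
parametrization preserves the directions of lattice paths when passing to antipodes,
as needed for cup products, which depend on the order of the vertices.\<close>

fun crosspt :: "(nat \<Rightarrow> real) \<Rightarrow> (nat \<Rightarrow> real) \<Rightarrow> nat \<Rightarrow> nat \<Rightarrow> real" where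
  "crosspt u e 0 = (\<lambda>t. if t = 0 then 1 else 0)"
| "crosspt u e (Suc k) = (\<lambda>t. if t = Suc k then u k else (1 - u k) * e k * crosspt u e k t)"

lemma crosspt_support: "t > k \<Longrightarrow> crosspt u e k t = 0"
  by (induction k) auto

lemma crosspt_norm:
  assumes "\<And>t. t < k \<Longrightarrow> 0 \<le> u t \<and> u t \<le> 1 \<and> \<bar>e t\<bar> = 1"
  shows "(\<Sum>t\<le>k. \<bar>crosspt u e k t\<bar>) = 1"
  using assms
proof (induction k)
  case (Suc k)
  have "(\<Sum>t\<le>k. \<bar>crosspt u e (Suc k) t\<bar>) = (\<Sum>t\<le>k. (1 - u k) * \<bar>crosspt u e k t\<bar>)"
    using Suc.prems[of k] by (intro sum.cong) (auto simp: abs_mult)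
  also have "\<dots> = 1 - u k"
    using Suc by (simp flip: sum_distrib_left)
  finally show ?case
    using Suc.prems[of k] by simp
qed simp

lemma crosspt_nonzero:
  assumes "\<And>t. e t \<noteq> 0"
  shows "crosspt u e k \<noteq> (\<lambda>_. 0)"
proof (induction k)
  case (Suc k)
  then obtain t where "crosspt u e k t \<noteq> 0"
    by auto
  moreover from this have "t \<noteq> Suc k"
    using crosspt_support[of k t u e] by auto
  ultimately show ?case
    using assms[of k] by (cases "u k = 0") (auto simp: fun_eq_iff)
qed (auto simp: fun_eq_iff)

text \<open>At parameter \<open>1\<close> the tip of the cone is reached, and the sign before it has no influence.\<close>

lemma crosspt_cong:
  assumes "\<And>t. t < k \<Longrightarrow> u t = u' t \<and> (u t \<noteq> 1 \<longrightarrow> e t = e' t)"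
  shows "crosspt u e k = crosspt u' e' k"
  using assms
proof (induction k)
  case (Suc k)
  then have "crosspt u e k = crosspt u' e' k"
    by simp
  with Suc.prems[of k] show ?case
    by auto
qed simp

text \<open>The facet where the last parameter vanishes is the hemisphere of one dimension less, or its antipode.\<close>

lemma crosspt_face:
  assumes "u k = 0"
  shows "crosspt u e (Suc k) = (\<lambda>t. e k * crosspt u e k t)"
  using assms by (auto simp: crosspt_support)

text \<open>If the parameter \<open>u c\<close> vanishes, then stage \<open>c\<close> only changes a sign, and the next stage sees the
product of two signs. So these facets cancel in pairs when summing over all signs.\<close>

lemma crosspt_flip_two:
  assumes "u c = 0" and "Suc c < k"
    and "e' c = - e c" "e' (Suc c) = - e (Suc c)" "\<And>t. t \<noteq> c \<Longrightarrow> t \<noteq> Suc c \<Longrightarrow> e' t = e t"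
  shows "crosspt u e' k = crosspt u e k"
  using assms(2)
proof (induction k)
  case (Suc k)
  show ?case
  proof (cases "k = Suc c")
    case True
    have "crosspt u e' c = crosspt u e c"
      using assms by (intro crosspt_cong) auto
    then show ?thesis
      using True assms crosspt_face[where k = c and u = u]
      by (auto simp: fun_eq_iff crosspt_support)
  next
    case False
    moreover from this have "e' k = e k"
      using Suc.prems by (intro assms(5)) auto
    ultimately show ?thesis
      using Suc by (auto simp: fun_eq_iff)
  qed
qed simp

lemma crosspt_Lipschitz:
  assumes "\<And>t. t < k \<Longrightarrow> 0 \<le> u t \<and> u t \<le> 1 \<and> 0 \<le> u' t \<and> u' t \<le> 1 \<and> \<bar>e t\<bar> = 1 \<and> \<bar>u t - u' t\<bar> \<le> \<delta>"
    and "0 \<le> \<delta>"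
  shows "\<bar>crosspt u e k t - crosspt u' e k t\<bar> \<le> real k * \<delta>"
  using assms(1)
proof (induction k)
  case (Suc k)
  let ?p = "crosspt u e k t" and ?p' = "crosspt u' e k t"
  have IH: "\<bar>?p - ?p'\<bar> \<le> real k * \<delta>"
    using Suc by simp
  have k: "0 \<le> u k" "u k \<le> 1" "\<bar>e k\<bar> = 1" "\<bar>u k - u' k\<bar> \<le> \<delta>"
    using Suc.prems[of k] by auto
  have p': "\<bar>?p'\<bar> \<le> 1"
  proof (cases "t \<le> k")
    case True
    then have "\<bar>?p'\<bar> \<le> (\<Sum>t\<le>k. \<bar>crosspt u' e k t\<bar>)"
      by (intro member_le_sum) auto
    also have "\<dots> = 1"
      using Suc.prems by (intro crosspt_norm) auto
    finally show ?thesis .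
  qed (simp add: crosspt_support)
  show ?case
  proof (cases "t = Suc k")
    case True
    then show ?thesis
      using k assms(2) by (simp add: distrib_right) (smt (verit) mult_nonneg_nonneg of_nat_0_le_iff)
  next
    case False
    then have "crosspt u e (Suc k) t - crosspt u' e (Suc k) t
        = e k * ((1 - u k) * (?p - ?p') + (u' k - u k) * ?p')"
      by (simp add: algebra_simps)
    also have "\<bar>\<dots>\<bar> \<le> \<bar>1 - u k\<bar> * \<bar>?p - ?p'\<bar> + \<bar>u' k - u k\<bar> * \<bar>?p'\<bar>"
      using k(3) by (simp add: abs_mult) (metis abs_mult abs_triangle_ineq)
    also have "\<dots> \<le> 1 * (real k * \<delta>) + \<delta> * 1"
      using k IH p' assms(2) by (intro add_mono mult_mono) auto
    finally show ?thesis
      by (simp add: algebra_simps)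
  qed
qed simp

definition cube_coords :: "nat \<Rightarrow> (nat \<Rightarrow> nat) \<Rightarrow> (nat \<times> nat) set" where
  "cube_coords n a = Sigma {..<n} (\<lambda>i. {..<a i})"

text \<open>A point of a product of spheres, with row \<open>i\<close> on a sphere of dimension \<open>a i\<close>. The parameters are
subdivided into \<open>L\<close> steps, and \<open>E\<close> is the set of those stages that have a negative sign.\<close>

definition grid_point :: "nat \<Rightarrow> (nat \<Rightarrow> nat) \<Rightarrow> nat \<Rightarrow> (nat \<times> nat) set \<Rightarrow> (nat \<times> nat \<Rightarrow> nat) \<Rightarrow> nat \<Rightarrow> nat \<Rightarrow> real" where
  "grid_point n a L E v = (\<lambda>i. if i < n
     then crosspt (\<lambda>t. real (v (i, t)) / real L) (\<lambda>t. if (i, t) \<in> E then -1 else 1) (a i)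
     else (\<lambda>_. 0))"

definition flip_row :: "nat \<Rightarrow> (nat \<Rightarrow> nat \<Rightarrow> real) \<Rightarrow> nat \<Rightarrow> nat \<Rightarrow> real" where
  "flip_row i x = x(i := (\<lambda>t. - x i t))"

text \<open>The set \<open>\<kappa>\<close> encodes a character of the group of sign changes of the rows: the rows on
which the sign cochain \<open>s\<close> is odd.\<close>

definition has_parity :: "nat \<Rightarrow> ((nat \<Rightarrow> nat \<Rightarrow> real) \<Rightarrow> bit) \<Rightarrow> nat set \<Rightarrow> bool" where
  "has_parity n s \<kappa> \<longleftrightarrow>
    (\<forall>x i. (\<forall>i<n. x i \<noteq> (\<lambda>_. 0)) \<longrightarrow> i < n \<longrightarrow> s (flip_row i x) = s x + of_bool (i \<in> \<kappa>))"

text \<open>The pairing of the cup product of coboundaries with the product of the hemispheres of dimensions \<open>a i\<close>.\<close>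

definition crossings :: "nat \<Rightarrow> (nat \<Rightarrow> nat) \<Rightarrow> nat \<Rightarrow> ((nat \<Rightarrow> nat \<Rightarrow> real) \<Rightarrow> bit) list \<Rightarrow> bit" where
  "crossings n a L ss = (\<Sum>E\<in>Pow (cube_coords n a). \<Sum>v\<in>grid L (cube_coords n a).
     path_sum (map (\<lambda>s v. s (grid_point n a L E v)) ss) (cube_coords n a) v)"

lemma finite_cube_coords [simp]: "finite (cube_coords n a)"
  by (simp add: cube_coords_def)

lemma card_cube_coords: "card (cube_coords n a) = (\<Sum>i<n. a i)"
  by (simp add: cube_coords_def)

lemma grid_point_row_nonzero: "i < n \<Longrightarrow> grid_point n a L E v i \<noteq> (\<lambda>_. 0)"
  unfolding grid_point_def by (simp add: crosspt_nonzero)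

lemma grid_point_full_face:
  assumes "L > 0" "v c = L"
  shows "grid_point n a L (sym_diff E {c}) v = grid_point n a L E v"
proof
  fix i
  show "grid_point n a L (sym_diff E {c}) v i = grid_point n a L E v i"
    using assms by (auto simp: grid_point_def intro!: crosspt_cong)
qed

lemma grid_point_inner_face:
  assumes "v (i, t) = 0" "Suc t < a i"
  shows "grid_point n a L (sym_diff E {(i, t), (i, Suc t)}) v = grid_point n a L E v"
proof
  fix i'
  show "grid_point n a L (sym_diff E {(i, t), (i, Suc t)}) v i' = grid_point n a L E v i'"
  proof (cases "i' = i \<and> i < n")
    case True
    have "crosspt (\<lambda>t. real (v (i, t)) / real L)
        (\<lambda>t'. if (i, t') \<in> sym_diff E {(i, t), (i, Suc t)} then - 1 else 1) (a i)
      = crosspt (\<lambda>t. real (v (i, t)) / real L) (\<lambda>t'. if (i, t') \<in> E then - 1 else 1) (a i)"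
      using assms by (intro crosspt_flip_two[where c = t]) auto
    with True show ?thesis
      by (simp add: grid_point_def)
  next
    case False
    then show ?thesis
      by (auto simp: grid_point_def intro!: crosspt_cong)
  qed
qed

lemma grid_point_outer_face:
  assumes "v (i, a i - 1) = 0" "0 < a i" "i < n"
  shows "grid_point n a L E v = (if (i, a i - 1) \<in> E then flip_row i (grid_point n (a(i := a i - 1)) L E v)
                         else grid_point n (a(i := a i - 1)) L E v)"
proof
  fix i'
  obtain k where k: "a i = Suc k"
    using assms(2) gr0_implies_Suc by blast
  show "grid_point n a L E v i' = (if (i, a i - 1) \<in> E then flip_row i (grid_point n (a(i := a i - 1)) L E v)
                         else grid_point n (a(i := a i - 1)) L E v) i'"
    using assms k by (cases "i' = i") (auto simp: grid_point_def flip_row_def crosspt_face simp del: crosspt.simps(2))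
qed

lemma grid_point_independent:
  assumes "c \<notin> cube_coords n a" 
  shows "grid_point n a L (insert c E) v = grid_point n a L E v" and "grid_point n a L E (v(c := b)) = grid_point n a L E v"
  using assms by (auto simp: grid_point_def cube_coords_def fun_eq_iff intro!: crosspt_cong[THEN fun_cong])


lemma sum_Pow_insert:
  fixes h :: "'a set \<Rightarrow> 'b::comm_monoid_add"
  assumes "finite C" "c \<in> C"
  shows "(\<Sum>E\<in>Pow C. h E) = (\<Sum>E\<in>Pow (C - {c}). h E + h (insert c E))"
proof -
  have "Pow C = Pow (C - {c}) \<union> insert c ` Pow (C - {c})"
    using Pow_insert[of c "C - {c}"] assms(2) by (simp add: insert_absorb)
  moreover have "Pow (C - {c}) \<inter> insert c ` Pow (C - {c}) = {}"
    by auto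
  moreover have "inj_on (insert c) (Pow (C - {c}))"
    by (auto simp: inj_on_def) 
  ultimately show ?thesis
    using assms(1) by (simp add: sum.union_disjoint sum.reindex sum.distrib)
qed

lemma sum_Pow_flip_eq_0:
  fixes h :: "'a set \<Rightarrow> bit"
  assumes "finite C" "K \<subseteq> C" "K \<noteq> {}" and "\<And>E. h (sym_diff E K) = h E"
  shows "(\<Sum>E\<in>Pow C. h E) = 0"
  using assms by (intro sum_bit_involution[where \<phi> = "\<lambda>E. sym_diff E K"]) auto

text \<open>The recursion of the coefficient of \<open>\<Prod>i. t\<^sub>i ^ a i\<close> in the product of the linear forms
\<open>\<Sum>i\<in>\<kappa>. t\<^sub>i\<close>. Stokes' theorem removes the first cochain. On the boundary of the product of
hemispheres, all facets cancel in pairs except those where the last stage of a row \<open>i\<close> has parameter \<open>0\<close>;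
these form the product with a hemisphere of one dimension less in row \<open>i\<close>, taken together with its reflection. The
remaining cochains have equal path sums on both, whereas the first one contributes \<open>s + s \<circ> flip\<close>,
which is \<open>1\<close> if \<open>i \<in> \<kappa>\<close> and \<open>0\<close> otherwise.\<close>

lemma crossings_Cons:
  assumes "L > 0" and parity: "has_parity n s \<kappa>" "\<And>s'. s' \<in> set ss \<Longrightarrow> \<exists>\<kappa>'. has_parity n s' \<kappa>'"
    and card: "(\<Sum>i<n. a i) = Suc (length ss)"
  shows "crossings n a L (s # ss) = (\<Sum>i | i < n \<and> 0 < a i \<and> i \<in> \<kappa>. crossings n (a(i := a i - 1)) L ss)"
proof -
  let ?C = "cube_coords n a"
  define f where "f a E = (\<lambda>(s :: (nat \<Rightarrow> nat \<Rightarrow> real) \<Rightarrow> bit) v. s (grid_point n a L E v))" for a E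
  define h where "h c b v E = (let v' = v(c := if b then L else 0) in
    f a E s v' * path_sum (map (f a E) ss) (?C - {c}) v')" for c b v E
  define K where "K c b = (\<Sum>v\<in>grid L (?C - {c}). \<Sum>E\<in>Pow ?C. h c b v E)" for c b
  \<comment> \<open>The sum over the facets \<open>c = L\<close> (for \<open>b = True\<close>) and \<open>c = 0\<close> of the parameter cubes.\<close>
  have "crossings n a L (s # ss) = (\<Sum>E\<in>Pow ?C. \<Sum>c\<in>?C. \<Sum>v\<in>grid L (?C - {c}). \<Sum>b\<in>{True, False}. h c b v E)"
    unfolding crossings_def f_def[symmetric] list.map
    by (rule sum.cong[OF refl], subst path_sum_Stokes) (auto simp: card_cube_coords card h_def Let_def)
  also have "\<dots> = (\<Sum>c\<in>?C. \<Sum>v\<in>grid L (?C - {c}). \<Sum>b\<in>{True, False}. \<Sum>E\<in>Pow ?C. h c b v E)"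
    by (subst sum.swap, rule sum.cong[OF refl], subst sum.swap, rule sum.cong[OF refl], subst sum.swap, rule refl)
  also have "\<dots> = (\<Sum>c\<in>?C. K c True + K c False)"
    by (simp add: K_def sum.distrib)
  also have "\<dots> = (\<Sum>c\<in>?C. K c False)"
  proof -
    \<comment> \<open>At the tip of a cone the sign of that stage is irrelevant.\<close>
    have "h c True v (sym_diff E {c}) = h c True v E" if "c \<in> ?C" for c v E
    proof -
      have eq: "f a (sym_diff E {c}) s' v' = f a E s' v'" if "v' c = L" for s' v'
        using grid_point_full_face[OF \<open>L > 0\<close>, of v' c n a E] that by (simp add: f_def)
      have "path_sum (map (f a (sym_diff E {c})) ss) (?C - {c}) (v(c := L))
          = path_sum (map (f a E) ss) (?C - {c}) (v(c := L))"
      proof (rule path_sum_cong, intro exI allI impI)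
        fix s' v' assume "\<forall>c'. c' \<notin> ?C - {c} \<longrightarrow> v' c' = (v(c := L)) c'"
        then have "v' c = L"
          by (metis Diff_iff fun_upd_same singletonI)
        then show "f a (sym_diff E {c}) s' v' = f a E s' v' + 0"
          using eq by simp
      qed
      then show ?thesis
        using eq[of "v(c := L)" s] by (simp add: h_def)
    qed
    then have "K c True = 0" if "c \<in> ?C" for c
      using that unfolding K_def
      by (intro sum.neutral ballI sum_Pow_flip_eq_0[where K = "{c}"]) auto
    then show ?thesis
      by simp
  qed
  also have "\<dots> = (\<Sum>i<n. \<Sum>t<a i. K (i, t) False)"
    unfolding cube_coords_def by (simp add: sum.Sigma)
  also have "\<dots> = (\<Sum>i<n. if 0 < a i \<and> i \<in> \<kappa> then crossings n (a(i := a i - 1)) L ss else 0)"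
  proof (rule sum.cong[OF refl])
    fix i assume "i \<in> {..<n}"
    then have i: "i < n" by simp
    \<comment> \<open>Simultaneous change of two consecutive signs preserves the facet.\<close>
    have inner: "K (i, t) False = 0" if "Suc t < a i" for t
    proof -
      let ?F = "{(i, t), (i, Suc t)}" and ?c = "(i, t)"
      have "h ?c False v (sym_diff E ?F) = h ?c False v E" for v E
      proof -
        have eq: "f a (sym_diff E ?F) s' v' = f a E s' v'" if "v' ?c = 0" for s' v'
          using grid_point_inner_face[of v' i t a n L E] that \<open>Suc t < a i\<close> by (simp add: f_def)
        have "path_sum (map (f a (sym_diff E ?F)) ss) (?C - {?c}) (v(?c := 0))
            = path_sum (map (f a E) ss) (?C - {?c}) (v(?c := 0))"
          by (rule path_sum_cong) (auto intro!: exI[of _ 0] eq)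
        then show ?thesis
          using eq[of "v(?c := 0)" s] by (simp add: h_def)
      qed
      then show ?thesis
        using i that unfolding K_def
        by (intro sum.neutral ballI sum_Pow_flip_eq_0[where K = ?F]) (auto simp: cube_coords_def)
    qed
    \<comment> \<open>The two signs of the last stage give a point and its reflection.\<close>
    have outer: "K (i, a i - 1) False = (if i \<in> \<kappa> then crossings n (a(i := a i - 1)) L ss else 0)" if "0 < a i"
    proof -
      let ?c = "(i, a i - 1)" and ?a = "a(i := a i - 1)"
      have C: "cube_coords n ?a = ?C - {?c}" and c: "?c \<in> ?C"
        using i that by (auto simp: cube_coords_def split: if_splits)
      have notin: "?c \<notin> cube_coords n ?a"
        unfolding C by simp
      have P: "h ?c False v E + h ?c False v (insert ?c E)
          = of_bool (i \<in> \<kappa>) * path_sum (map (f ?a E) ss) (cube_coords n ?a) v"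
        if E: "E \<in> Pow (?C - {?c})" for v E
      proof -
        let ?v = "v(?c := 0)"
        have eq0: "f a E s' v' = f ?a E s' v'" if "v' ?c = 0" for s' v'
          using grid_point_outer_face[of v' i a n L E] that i \<open>0 < a i\<close> E by (auto simp: f_def)
        have eq1: "f a (insert ?c E) s' v' = f ?a E s' v' + of_bool (i \<in> \<kappa>')"
          if "v' ?c = 0" "has_parity n s' \<kappa>'" for s' v' \<kappa>'
        proof -
          have "grid_point n a L (insert ?c E) v' = flip_row i (grid_point n ?a L (insert ?c E) v')"
            using grid_point_outer_face[of v' i a n L "insert ?c E"] that i \<open>0 < a i\<close> by auto
          also have "grid_point n ?a L (insert ?c E) v' = grid_point n ?a L E v'"
            by (rule grid_point_independent) (rule notin)
          finally show ?thesis
            using that(2) i unfolding has_parity_def f_def by (auto simp: grid_point_row_nonzero)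
        qed
        have p0: "path_sum (map (f a E) ss) (?C - {?c}) ?v = path_sum (map (f ?a E) ss) (?C - {?c}) ?v"
        proof (rule path_sum_cong, intro exI allI impI)
          fix s' v' assume "\<forall>c'. c' \<notin> ?C - {?c} \<longrightarrow> v' c' = ?v c'"
          then have "v' ?c = 0"
            by (metis Diff_iff fun_upd_same singletonI)
          then have "f a E s' v' = f ?a E s' v'"
            by (rule eq0)
          then show "f a E s' v' = f ?a E s' v' + 0"
            by simp
        qed
        have "path_sum (map (f a (insert ?c E)) ss) (?C - {?c}) ?v = path_sum (map (f ?a E) ss) (?C - {?c}) ?v"
        proof (rule path_sum_cong)
          fix s' assume "s' \<in> set ss"
          then obtain \<kappa>' where "has_parity n s' \<kappa>'"
            using parity(2) by blast
          show "\<exists>b. \<forall>v'. (\<forall>c. c \<notin> ?C - {?c} \<longrightarrow> v' c = ?v c) \<longrightarrow> f a (insert ?c E) s' v' = f ?a E s' v' + b"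
          proof (intro exI allI impI)
            fix v' assume "\<forall>c'. c' \<notin> ?C - {?c} \<longrightarrow> v' c' = ?v c'"
            then have "v' ?c = 0"
              by (metis Diff_iff fun_upd_same singletonI)
            then show "f a (insert ?c E) s' v' = f ?a E s' v' + of_bool (i \<in> \<kappa>')"
              using \<open>has_parity n s' \<kappa>'\<close> by (rule eq1)
          qed
        qed
        moreover have "f a E s ?v = f ?a E s ?v" 
          by (rule eq0) simp
        moreover have "f a (insert ?c E) s ?v = f ?a E s ?v + of_bool (i \<in> \<kappa>)"
          by (rule eq1[OF _ parity(1)]) simp
        moreover have "path_sum (map (f ?a E) ss) (?C - {?c}) ?v = path_sum (map (f ?a E) ss) (?C - {?c}) v"
          by (rule path_sum_independent) (auto simp only: f_def grid_point_independent(2)[OF notin] set_map)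
        ultimately show ?thesis
          using p0 unfolding h_def Let_def C by (simp add: distrib_right add.assoc[symmetric])
      qed
      have "K ?c False = (\<Sum>v\<in>grid L (?C - {?c}). \<Sum>E\<in>Pow (?C - {?c}). h ?c False v E + h ?c False v (insert ?c E))"
        unfolding K_def using c by (intro sum.cong refl sum_Pow_insert) auto
      also have "\<dots> = (\<Sum>v\<in>grid L (?C - {?c}). \<Sum>E\<in>Pow (?C - {?c}). of_bool (i \<in> \<kappa>) * path_sum (map (f ?a E) ss) (cube_coords n ?a) v)"
        using P by (intro sum.cong refl) auto
      also have "\<dots> = (if i \<in> \<kappa> then crossings n ?a L ss else 0)"
        unfolding crossings_def f_def[symmetric] C[symmetric] by (subst sum.swap) simp
      finally show ?thesis .
    qed
    show "(\<Sum>t<a i. K (i, t) False) = (if 0 < a i \<and> i \<in> \<kappa> then crossings n (a(i := a i - 1)) L ss else 0)"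
    proof (cases "a i")
      case (Suc k)
      then have "(\<Sum>t<a i. K (i, t) False) = (\<Sum>t<k. K (i, t) False) + K (i, k) False"
        by simp
      also have "(\<Sum>t<k. K (i, t) False) = 0"
        using inner Suc by simp
      finally show ?thesis
        using outer Suc by simp
    qed simp
  qed
  also have "\<dots> = (\<Sum>i | i < n \<and> 0 < a i \<and> i \<in> \<kappa>. crossings n (a(i := a i - 1)) L ss)"
    by (simp add: sum.If_cases Int_def)
  finally show ?thesis .
qed

section \<open>An equivariant Borsuk--Ulam theorem\<close>

text \<open>In the expansion of the product of the linear forms \<open>\<Sum>i\<in>\<kappa>. t\<^sub>i\<close>, taken from left to right, there is
exactly one choice of a variable from each factor that leads to the monomial \<open>\<Prod>i. t\<^sub>i ^ a i\<close>, because at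
each factor all but one of its variables are already used up. This makes the coefficient equal to one
without any computation.\<close>

inductive forced :: "nat \<Rightarrow> (nat \<Rightarrow> nat) \<Rightarrow> nat set list \<Rightarrow> bool" for n where
  forced_Nil: "(\<And>i. i < n \<Longrightarrow> a i = 0) \<Longrightarrow> forced n a []"
| forced_Cons: "{i. i < n \<and> 0 < a i \<and> i \<in> \<kappa>} = {j} \<Longrightarrow> forced n (a(j := a j - 1)) \<kappa>s \<Longrightarrow> forced n a (\<kappa> # \<kappa>s)"

lemma forced_length: "forced n a \<kappa>s \<Longrightarrow> (\<Sum>i<n. a i) = length \<kappa>s"
proof (induction rule: forced.induct)
  case (forced_Cons a \<kappa> j \<kappa>s)
  then have j: "j < n" "0 < a j"
    by auto
  have "(\<Sum>i<n. a i) = a j + (\<Sum>i\<in>{..<n} - {j}. a i)"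
    using j by (simp add: sum.remove)
  moreover have "(\<Sum>i<n. (a(j := a j - 1)) i) = a j - 1 + (\<Sum>i\<in>{..<n} - {j}. a i)"
    using j by (simp add: sum.remove)
  ultimately show ?case
    using forced_Cons.IH j by simp
qed simp

lemma crossings_forced:
  assumes "forced n a \<kappa>s" "list_all2 (has_parity n) ss \<kappa>s" "L > 0"
  shows "crossings n a L ss = 1"
  using assms(1,2)
proof (induction arbitrary: ss rule: forced.induct)
  case (forced_Nil a)
  then have "cube_coords n a = {}"
    by (auto simp: cube_coords_def)
  with forced_Nil show ?case
    by (simp add: crossings_def grid_def)
next
  case (forced_Cons a \<kappa> j \<kappa>s)
  then obtain s ss' where ss: "ss = s # ss'" "has_parity n s \<kappa>" "list_all2 (has_parity n) ss' \<kappa>s"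
    by (auto simp: list_all2_Cons2)
  have "(\<Sum>i<n. a i) = length (\<kappa> # \<kappa>s)"
    using forced_Cons by (intro forced_length forced.forced_Cons)
  also have "\<dots> = Suc (length ss')"
    using ss(3) by (simp add: list_all2_lengthD)
  finally have card: "(\<Sum>i<n. a i) = Suc (length ss')" .
  have "crossings n a L ss = (\<Sum>i | i < n \<and> 0 < a i \<and> i \<in> \<kappa>. crossings n (a(i := a i - 1)) L ss')"
    unfolding ss(1) using ss card \<open>L > 0\<close>
    by (intro crossings_Cons) (auto simp: list_all2_conv_all_nth in_set_conv_nth)
  also have "\<dots> = crossings n (a(j := a j - 1)) L ss'"
    unfolding forced_Cons.hyps(1) by simp
  also have "\<dots> = 1"
    by (rule forced_Cons.IH[OF ss(3)])
  finally show ?case .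
qed

definition unit_cell :: "'c set \<Rightarrow> ('c \<Rightarrow> nat) \<Rightarrow> ('c \<Rightarrow> nat) set" where
  "unit_cell I v = {u. \<forall>c. u c = v c \<or> c \<in> I \<and> u c = Suc (v c)}"

text \<open>A cup product is nonzero on a simplex only if each of its factors is nonzero on some edge.\<close>

lemma path_sum_nonzero:
  assumes "path_sum ss I v \<noteq> 0" and "s \<in> set ss"
  shows "\<exists>u\<in>unit_cell I v. \<exists>u'\<in>unit_cell I v. s u \<noteq> s u'"
  using assms
proof (induction ss arbitrary: I v)
  case (Cons s' ss)
  then obtain i where i: "i \<in> I" "(s' v + s' (step i v)) * path_sum ss (I - {i}) (step i v) \<noteq> 0"
    unfolding path_sum.simps by (meson sum.neutral)
  then have *: "s' v + s' (step i v) \<noteq> 0" "path_sum ss (I - {i}) (step i v) \<noteq> 0"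
    by auto
  show ?case
  proof (cases "s = s'")
    case True
    have "v \<in> unit_cell I v" "step i v \<in> unit_cell I v"
      using i(1) by (auto simp: unit_cell_def step_def)
    moreover have "s' v \<noteq> s' (step i v)"
      using *(1) bit_add_eq_0_iff by blast
    ultimately show ?thesis
      using True by blast
  next
    case False
    then obtain u u' where u: "u \<in> unit_cell (I - {i}) (step i v)" "u' \<in> unit_cell (I - {i}) (step i v)" "s u \<noteq> s u'"
      using Cons.IH[OF *(2)] Cons.prems(2) by auto
    have "unit_cell (I - {i}) (step i v) \<subseteq> unit_cell I v"
    proof
      fix u assume u: "u \<in> unit_cell (I - {i}) (step i v)"
      then have "u c = step i v c \<or> c \<in> I - {i} \<and> u c = Suc (step i v c)" for c
        unfolding unit_cell_def by blast
      then have "u c = v c \<or> c \<in> I \<and> u c = Suc (v c)" for c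
        using i(1) unfolding step_def by (metis DiffE fun_upd_apply singletonI)
      then show "u \<in> unit_cell I v"
        by (simp add: unit_cell_def)
    qed
    with u show ?thesis
      by blast
  qed
qed simp

definition sphere_rows :: "nat \<Rightarrow> (nat \<Rightarrow> nat) \<Rightarrow> (nat \<Rightarrow> nat \<Rightarrow> real) set" where
  "sphere_rows n a = {x. (\<forall>i<n. (\<forall>t>a i. x i t = 0) \<and> (\<Sum>t\<le>a i. \<bar>x i t\<bar>) = 1) \<and> (\<forall>i\<ge>n. \<forall>t. x i t = 0)}"

lemma grid_point_in_sphere_rows:
  assumes "L > 0" and "\<And>c. c \<in> cube_coords n a \<Longrightarrow> v c \<le> L"
  shows "grid_point n a L E v \<in> sphere_rows n a"
  using assms
  by (auto simp: sphere_rows_def grid_point_def crosspt_support cube_coords_def intro!: crosspt_norm)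

text \<open>The mesh of the subdivided product of spheres tends to zero as \<open>L\<close> grows.\<close>

lemma grid_point_unit_cell_close:
  assumes "L > 0" and "v \<in> grid L (cube_coords n a)" and "u \<in> unit_cell (cube_coords n a) v"
  shows "\<bar>grid_point n a L E u i t - grid_point n a L E v i t\<bar> \<le> real (\<Sum>i<n. a i) / real L"
proof (cases "i < n")
  case True
  have "\<bar>real (u (i, t)) / real L - real (v (i, t)) / real L\<bar> \<le> 1 / real L
      \<and> u (i, t) \<le> L \<and> v (i, t) \<le> L" if "t < a i" for t
  proof -
    have "(i, t) \<in> cube_coords n a"
      using True that by (simp add: cube_coords_def)
    then have "v (i, t) < L" and "u (i, t) = v (i, t) \<or> u (i, t) = Suc (v (i, t))"
      using assms by (auto simp: grid_def unit_cell_def)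
    then show ?thesis
      using assms(1) by (auto simp: field_simps)
  qed
  then have "\<bar>grid_point n a L E u i t - grid_point n a L E v i t\<bar> \<le> real (a i) * (1 / real L)"
    using True assms(1) unfolding grid_point_def by (simp only: if_True) (rule crosspt_Lipschitz, auto)
  also have "\<dots> \<le> real (\<Sum>i<n. a i) / real L"
    using True assms(1) member_le_sum[of i "{..<n}" a] by (simp add: divide_right_mono del: of_nat_sum)
  finally show ?thesis .
qed (auto simp: grid_point_def intro!: divide_nonneg_nonneg sum_nonneg)

lemma continuous_on_entry [continuous_intros]:
  "continuous_on S (\<lambda>x :: nat \<Rightarrow> nat \<Rightarrow> real. x i t)"
proof -
  have "continuous_on UNIV (\<lambda>x :: nat \<Rightarrow> nat \<Rightarrow> real. x i)"
    by (rule continuous_on_product_then_coordinatewise[OF continuous_on_id])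
  then have "continuous_on UNIV (\<lambda>x :: nat \<Rightarrow> nat \<Rightarrow> real. x i t)"
    by (rule continuous_on_product_then_coordinatewise)
  then show ?thesis
    by (rule continuous_on_subset) simp
qed

lemma tendsto_coordinatewise:
  fixes f :: "'a \<Rightarrow> 'b \<Rightarrow> 'c::topological_space"
  assumes "\<And>i. ((\<lambda>x. f x i) \<longlongrightarrow> l i) F"
  shows "(f \<longlongrightarrow> l) F"
  using assms limitin_componentwise[of "\<lambda>_. euclidean" UNIV f l F]
  by (simp add: euclidean_product_topology)

lemma compact_PiE_UNIV:
  fixes S :: "'a \<Rightarrow> 'b::topological_space set"
  assumes "\<And>i. compact (S i)"
  shows "compact (PiE UNIV S)"
  using assms compactin_PiE[of "\<lambda>_. euclidean" UNIV S]
  by (auto simp: euclidean_product_topology compactin_euclidean_iff)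

lemma compact_sphere_rows: "compact (sphere_rows n a)"
proof -
  have "compact (PiE UNIV (\<lambda>_::nat. PiE UNIV (\<lambda>_::nat. {-1..1::real})))" (is "compact ?B")
    by (intro compact_PiE_UNIV compact_Icc)
  moreover have "closed (sphere_rows n a)"
  proof -
    have "closed {x :: nat \<Rightarrow> nat \<Rightarrow> real. x i t = 0}" for i t
      by (intro closed_Collect_eq continuous_intros)
    moreover have "closed {x :: nat \<Rightarrow> nat \<Rightarrow> real. (\<Sum>t\<le>a i. \<bar>x i t\<bar>) = 1}" for i
      by (intro closed_Collect_eq continuous_intros)
    moreover have "sphere_rows n a = (\<Inter>i\<in>{..<n}. (\<Inter>t\<in>{a i<..}. {x. x i t = 0}) \<inter> {x. (\<Sum>t\<le>a i. \<bar>x i t\<bar>) = 1})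
        \<inter> (\<Inter>i\<in>{n..}. \<Inter>t. {x. x i t = 0})"
      by (auto simp: sphere_rows_def)
    ultimately show ?thesis
      by (auto intro!: closed_INT closed_Int)
  qed
  moreover have "sphere_rows n a \<subseteq> ?B"
  proof
    fix x assume x: "x \<in> sphere_rows n a"
    have "\<bar>x i t\<bar> \<le> 1" for i t
    proof (cases "i < n \<and> t \<le> a i")
      case True
      then have "\<bar>x i t\<bar> \<le> (\<Sum>t\<le>a i. \<bar>x i t\<bar>)"
        by (intro member_le_sum) auto
      then show ?thesis
        using x True by (simp add: sphere_rows_def)
    next
      case False
      then have "x i t = 0"
        using x by (cases "i < n") (auto simp: sphere_rows_def)
      then show ?thesis by simp
    qed
    then show "x \<in> ?B"
      by (auto simp: PiE_iff abs_le_iff minus_le_iff)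
  qed
  ultimately show ?thesis
    by (metis compact_Int_closed inf.absorb_iff2)
qed

definition sign_bit :: "real \<Rightarrow> bit" where
  "sign_bit r = of_bool (r < 0)"

text \<open>Any odd function that is nonzero on nonzero rows would do; it breaks ties in the next definition.\<close>

definition lead_entry :: "(nat \<Rightarrow> real) \<Rightarrow> real" where
  "lead_entry r = r (LEAST t. r t \<noteq> 0)"

text \<open>At a zero of \<open>f\<close> the sign is chosen by the leading entries of the rows, so that the cochain has the
parity of \<open>f\<close> everywhere.\<close>

definition sign_cochain :: "((nat \<Rightarrow> nat \<Rightarrow> real) \<Rightarrow> real) \<Rightarrow> nat set \<Rightarrow> nat \<Rightarrow> (nat \<Rightarrow> nat \<Rightarrow> real) \<Rightarrow> bit" where
  "sign_cochain f \<kappa> n x = (if f x \<noteq> 0 then sign_bit (f x)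
     else (\<Sum>i\<in>\<kappa> \<inter> {..<n}. sign_bit (lead_entry (x i))))"

lemma sign_bit_minus: "r \<noteq> 0 \<Longrightarrow> sign_bit (- r) = sign_bit r + 1"
  by (cases "r < 0") (auto simp: sign_bit_def)

lemma lead_entry_nonzero:
  assumes "r \<noteq> (\<lambda>_. 0)"
  shows "lead_entry r \<noteq> 0"
proof -
  obtain t where "r t \<noteq> 0"
    using assms by auto
  then show ?thesis
    unfolding lead_entry_def by (rule LeastI)
qed

lemma lead_entry_minus: "lead_entry (\<lambda>t. - r t) = - lead_entry r"
  by (simp add: lead_entry_def)

lemma has_parity_sign_cochain:
  assumes f: "\<And>x i. i < n \<Longrightarrow> f (flip_row i x) = (if i \<in> \<kappa> then - f x else f x)"
  shows "has_parity n (sign_cochain f \<kappa> n) \<kappa>"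
  unfolding has_parity_def
proof (intro allI impI)
  fix x :: "nat \<Rightarrow> nat \<Rightarrow> real" and i
  assume x: "\<forall>i<n. x i \<noteq> (\<lambda>_. 0)" and i: "i < n"
  show "sign_cochain f \<kappa> n (flip_row i x) = sign_cochain f \<kappa> n x + of_bool (i \<in> \<kappa>)"
  proof (cases "f x = 0")
    case False
    then show ?thesis
      using f[OF i, of x] by (auto simp: sign_cochain_def sign_bit_minus)
  next
    case True
    let ?b = "\<lambda>x i. sign_bit (lead_entry (x i))"
    have f0: "f (flip_row i x) = 0"
      using f[OF i, of x] True by simp
    have other: "?b (flip_row i x) j = ?b x j" if "j \<noteq> i" for j
      using that by (simp add: flip_row_def)
    have same: "?b (flip_row i x) i = ?b x i + 1"
      using x i by (simp add: flip_row_def lead_entry_minus lead_entry_nonzero sign_bit_minus)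
    have "(\<Sum>j\<in>\<kappa> \<inter> {..<n}. ?b (flip_row i x) j) = (\<Sum>j\<in>\<kappa> \<inter> {..<n}. ?b x j + of_bool (j = i))"
      using same other by (intro sum.cong refl) auto
    also have "\<dots> = (\<Sum>j\<in>\<kappa> \<inter> {..<n}. ?b x j) + of_bool (i \<in> \<kappa>)"
      using i by (simp add: sum.distrib of_bool_def sum.delta')
    finally show ?thesis
      using True f0 by (simp add: sign_cochain_def)
  qed
qed

lemma sign_cochain_neq: "sign_cochain f \<kappa> n x \<noteq> sign_cochain f \<kappa> n y \<Longrightarrow> f x * f y \<le> 0"
  by (auto simp: sign_cochain_def sign_bit_def mult_le_0_iff split: if_splits)

text \<open>For every fineness, the number of crossings is odd, so there is a small simplex on which each of the functions
changes sign. By compactness these simplices accumulate at a point, where all functions vanish.\<close>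

theorem equivariant_common_zero:
  fixes fs :: "(((nat \<Rightarrow> nat \<Rightarrow> real) \<Rightarrow> real) \<times> nat set) list"
  assumes forced: "forced n a (map snd fs)"
    and cont: "\<And>f \<kappa>. (f, \<kappa>) \<in> set fs \<Longrightarrow> continuous_on (sphere_rows n a) f"
    and odd: "\<And>f \<kappa> x i. (f, \<kappa>) \<in> set fs \<Longrightarrow> i < n \<Longrightarrow> f (flip_row i x) = (if i \<in> \<kappa> then - f x else f x)"
  shows "\<exists>x\<in>sphere_rows n a. \<forall>(f, \<kappa>)\<in>set fs. f x = 0"
proof -
  let ?A = "real (\<Sum>i<n. a i)"
  let ?X = "sphere_rows n a"
  define ss where "ss = map (\<lambda>(f, \<kappa>). sign_cochain f \<kappa> n) fs"
  have parity: "list_all2 (has_parity n) ss (map snd fs)"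
    unfolding ss_def list_all2_map1 list_all2_map2
    by (rule list_all2_all_nthI) (auto simp: split_def intro!: has_parity_sign_cochain odd[of _ "snd _"]
        nth_mem simp flip: surjective_pairing)
  define close where "close L x y \<longleftrightarrow> y \<in> ?X \<and> (\<forall>i t. \<bar>y i t - x i t\<bar> \<le> ?A / real (Suc L))"
    for L and x y :: "nat \<Rightarrow> nat \<Rightarrow> real"
  define good where "good L x \<longleftrightarrow> (\<forall>f \<kappa>. (f, \<kappa>) \<in> set fs \<longrightarrow> (\<exists>y z. close L x y \<and> close L x z \<and> f y * f z \<le> 0))"
    for L and x :: "nat \<Rightarrow> nat \<Rightarrow> real"
  have "\<exists>x. x \<in> ?X \<and> good L x" for L
  proof -
    let ?C = "cube_coords n a"
    have "crossings n a (Suc L) ss \<noteq> 0"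
      using crossings_forced[OF forced parity, of "Suc L"] by simp
    then obtain E v where v: "v \<in> grid (Suc L) ?C"
      and nz: "path_sum (map (\<lambda>s v. s (grid_point n a (Suc L) E v)) ss) ?C v \<noteq> 0"
      unfolding crossings_def by (meson sum.neutral)
    have unit_cell: "grid_point n a (Suc L) E u \<in> ?X" if "u \<in> unit_cell ?C v" for u
    proof (rule grid_point_in_sphere_rows)
      fix c assume "c \<in> ?C"
      then have "v c < Suc L"
        using v by (auto simp: grid_def)
      moreover have "u c \<le> Suc (v c)"
      proof -
        have "u c = v c \<or> u c = Suc (v c)"
          using that unfolding unit_cell_def by blast
        then show ?thesis by auto
      qed
      ultimately show "u c \<le> Suc L" by simp
    qed simp
    have close: "close L (grid_point n a (Suc L) E v) (grid_point n a (Suc L) E u)" if "u \<in> unit_cell ?C v" for u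
      unfolding close_def using unit_cell[OF that] grid_point_unit_cell_close[OF _ v that, of E] by simp
    have "good L (grid_point n a (Suc L) E v)"
      unfolding good_def
    proof (intro allI impI)
      fix f \<kappa> assume "(f, \<kappa>) \<in> set fs"
      then have "sign_cochain f \<kappa> n \<in> set ss"
        by (force simp: ss_def)
      then obtain u u' where u: "u \<in> unit_cell ?C v" "u' \<in> unit_cell ?C v"
        "sign_cochain f \<kappa> n (grid_point n a (Suc L) E u) \<noteq> sign_cochain f \<kappa> n (grid_point n a (Suc L) E u')"
        using path_sum_nonzero[OF nz, of "\<lambda>v. sign_cochain f \<kappa> n (grid_point n a (Suc L) E v)"] by auto
      then show "\<exists>y z. close L (grid_point n a (Suc L) E v) y \<and> close L (grid_point n a (Suc L) E v) z \<and> f y * f z \<le> 0"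
        using close sign_cochain_neq by blast
    qed
    moreover have "grid_point n a (Suc L) E v \<in> ?X"
      by (rule unit_cell) (auto simp: unit_cell_def)
    ultimately show ?thesis
      by blast
  qed
  then obtain x where x: "\<And>L. x L \<in> ?X" and good: "\<And>L. good L (x L)"
    by metis
  obtain x0 r where x0: "x0 \<in> ?X" and r: "strict_mono r" "(x \<circ> r) \<longlonglongrightarrow> x0"
    using compact_imp_seq_compact[OF compact_sphere_rows, of n a] x unfolding seq_compact_def by metis
  have small: "(\<lambda>L. ?A / real (Suc (r L))) \<longlonglongrightarrow> 0"
    using LIMSEQ_subseq_LIMSEQ[OF LIMSEQ_Suc[OF lim_const_over_n[of ?A]] r(1)] by (simp add: o_def)
  \<comment> \<open>Sequences that stay close to the chosen ones have the same limit.\<close>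
  have lim: "y \<longlonglongrightarrow> x0" if y: "\<And>L i t. \<bar>y L i t - x (r L) i t\<bar> \<le> ?A / real (Suc (r L))" for y :: "nat \<Rightarrow> nat \<Rightarrow> nat \<Rightarrow> real"
  proof (intro tendsto_coordinatewise)
    fix i t
    have "continuous_on UNIV (\<lambda>x :: nat \<Rightarrow> nat \<Rightarrow> real. x i t)"
      by (rule continuous_on_entry)
    then have "(\<lambda>L. x (r L) i t) \<longlonglongrightarrow> x0 i t"
      using continuous_on_tendsto_compose[OF _ r(2), of UNIV "\<lambda>x. x i t"] by (simp add: o_def)
    moreover have "(\<lambda>L. y L i t - x (r L) i t) \<longlonglongrightarrow> 0"
      using y by (intro Lim_null_comparison[OF _ small]) auto
    ultimately have "(\<lambda>L. (y L i t - x (r L) i t) + x (r L) i t) \<longlonglongrightarrow> 0 + x0 i t"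
      by (intro tendsto_add)
    then show "(\<lambda>L. y L i t) \<longlonglongrightarrow> x0 i t"
      by simp
  qed
  have "f x0 = 0" if f: "(f, \<kappa>) \<in> set fs" for f \<kappa>
  proof -
    have "\<forall>L. \<exists>y z. close L (x L) y \<and> close L (x L) z \<and> f y * f z \<le> 0"
      using good f unfolding good_def by blast
    then obtain y z where y: "\<And>L. close L (x L) (y L)" and z: "\<And>L. close L (x L) (z L)"
      and le0: "\<And>L. f (y L) * f (z L) \<le> 0"
      by metis
    have "(\<lambda>L. f (y (r L))) \<longlonglongrightarrow> f x0" "(\<lambda>L. f (z (r L))) \<longlonglongrightarrow> f x0"
      using y z unfolding close_def
      by (auto intro!: continuous_on_tendsto_compose[OF cont[OF f] lim x0])
    then have "(\<lambda>L. f (y (r L)) * f (z (r L))) \<longlonglongrightarrow> f x0 * f x0"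
      by (rule tendsto_mult)
    then have "f x0 * f x0 \<le> 0"
      using le0 by (intro LIMSEQ_le_const2) auto
    then show ?thesis
      by (auto simp: mult_le_0_iff)
  qed
  with x0 show ?thesis
    by blast
qed

section \<open>Orthogonal frames\<close>

lemma forced_replicate:
  assumes "i < n" "r \<le> a i" "forced n (a(i := a i - r)) \<kappa>s"
  shows "forced n a (replicate r {i} @ \<kappa>s)"
  using assms(2,3)
proof (induction r arbitrary: a)
  case (Suc r)
  have upd: "(a(i := a i - 1))(i := (a(i := a i - 1)) i - r) = a(i := a i - Suc r)"
    by (simp add: fun_eq_iff)
  have "forced n (a(i := a i - 1)) (replicate r {i} @ \<kappa>s)"
  proof (rule Suc.IH)
    show "forced n ((a(i := a i - 1))(i := (a(i := a i - 1)) i - r)) \<kappa>s"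
      unfolding upd by (rule Suc.prems(2))
  qed (use Suc.prems(1) in simp)
  moreover have "{i'. i' < n \<and> 0 < a i' \<and> i' \<in> {i}} = {i}"
    using Suc.prems assms(1) by auto
  ultimately show ?case
    unfolding replicate_Suc append_Cons by (rule forced_Cons[rotated])
qed simp

lemma forced_pairs:
  assumes "i < n" "a i = 0" "distinct js" "\<And>j. j \<in> set js \<Longrightarrow> j < n \<and> 0 < a j"
    and "forced n (\<lambda>t. if t \<in> set js then a t - 1 else a t) \<kappa>s"
  shows "forced n a (map (\<lambda>j. {i, j}) js @ \<kappa>s)"
  using assms(2-)
proof (induction js arbitrary: a)
  case (Cons j js)
  have "j < n \<and> 0 < a j"
    by (rule Cons.prems(3)) simp
  then have j: "j \<noteq> i" "j < n" "0 < a j" "j \<notin> set js"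
    using Cons.prems(1,2) by auto
  define a' where "a' = a(j := a j - 1)"
  have "(if t \<in> set (j # js) then a t - 1 else a t) = (if t \<in> set js then a' t - 1 else a' t)" for t
    using j by (auto simp: a'_def)
  then have "forced n (\<lambda>t. if t \<in> set js then a' t - 1 else a' t) \<kappa>s"
    using Cons.prems(4) by (simp only:)
  moreover have "j' < n \<and> 0 < a' j'" if "j' \<in> set js" for j'
  proof -
    have "j' < n \<and> 0 < a j'"
      by (rule Cons.prems(3)) (simp add: that)
    then show ?thesis
      using that j by (auto simp: a'_def)
  qed
  moreover have "a' i = 0" "distinct js"
    using Cons.prems(1,2) j by (auto simp: a'_def)
  ultimately have "forced n a' (map (\<lambda>j. {i, j}) js @ \<kappa>s)"
    by (intro Cons.IH)
  moreover have "{i'. i' < n \<and> 0 < a i' \<and> i' \<in> {i, j}} = {j}"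
    using Cons.prems(1) j by auto
  ultimately show ?case
    unfolding list.map append_Cons a'_def by (rule forced_Cons[rotated])
qed simp

text \<open>The degrees left before treating row \<open>i\<close> are zero for the earlier rows and \<open>M + t - i\<close> for the rows
\<open>t \<ge> i\<close>. The \<open>M\<close> equations of row \<open>i\<close> alone use up its degree \<open>M\<close>; after that, the equation that couples it to a
later row \<open>j\<close> can only be charged to row \<open>j\<close>.\<close>

lemma forced_flag:
  assumes "i \<le> n"
  shows "forced n (\<lambda>t. if t < i then 0 else M + t - i)
    (concat (map (\<lambda>i. replicate M {i} @ map (\<lambda>j. {i, j}) [Suc i..<n]) [i..<n]))"
  using assms
proof (induction rule: inc_induct)
  case base
  then show ?case
    by (auto intro: forced_Nil)
next
  case (step i)
  let ?rest = "concat (map (\<lambda>i. replicate M {i} @ map (\<lambda>j. {i, j}) [Suc i..<n]) [Suc i..<n])"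
  let ?a = "\<lambda>t. if t < i then 0 else M + t - i"
  let ?a' = "?a(i := ?a i - M)"
  have "(\<lambda>t. if t \<in> set [Suc i..<n] then ?a' t - 1 else ?a' t)
      = (\<lambda>t. if t < Suc i then 0 else if t < n then M + t - Suc i else M + t - i)"
    by (auto simp: fun_eq_iff)
  moreover have "forced n (\<lambda>t. if t < Suc i then 0 else if t < n then M + t - Suc i else M + t - i) ?rest"
  proof -
    have *: "forced n a' \<kappa>s" if "forced n a \<kappa>s" "\<And>t. t < n \<Longrightarrow> a t = a' t" for a a' \<kappa>s
      using that
    proof (induction arbitrary: a' rule: forced.induct)
      case (forced_Nil a)
      then show ?case by (auto intro: forced.forced_Nil)
    next
      case (forced_Cons a \<kappa> j \<kappa>s)
      have "{i. i < n \<and> 0 < a' i \<and> i \<in> \<kappa>} = {i. i < n \<and> 0 < a i \<and> i \<in> \<kappa>}"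
        using forced_Cons.prems by auto
      moreover have "forced n (a'(j := a' j - 1)) \<kappa>s"
        using forced_Cons.prems forced_Cons.hyps(1) by (intro forced_Cons.IH) auto
      ultimately show ?case
        using forced_Cons.hyps(1) by (metis forced.forced_Cons)
    qed
    show ?thesis
      by (rule *[OF step.IH]) auto
  qed
  ultimately have "forced n ?a' (map (\<lambda>j. {i, j}) [Suc i..<n] @ ?rest)"
    using step.hyps by (intro forced_pairs) auto
  then have "forced n ?a (replicate M {i} @ map (\<lambda>j. {i, j}) [Suc i..<n] @ ?rest)"
    using step.hyps by (intro forced_replicate) auto
  moreover have "[i..<n] = i # [Suc i..<n]"
    using step.hyps by (simp add: upt_conv_Cons)
  ultimately show ?case
    by simp
qed

text \<open>Taking row \<open>i\<close> from a sphere of dimension \<open>M + i\<close> makes the total dimension equal to the number of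
equations: \<open>M\<close> odd ones for each row, and one orthogonality relation for each pair of rows.\<close>

theorem Stiefel_common_zero:
  fixes G :: "nat \<Rightarrow> nat \<Rightarrow> (nat \<Rightarrow> nat \<Rightarrow> real) \<Rightarrow> real"
  assumes cont: "\<And>i r. i < n \<Longrightarrow> r < M \<Longrightarrow> continuous_on (sphere_rows n (\<lambda>i. M + i)) (G i r)"
    and odd: "\<And>i r i' x. i < n \<Longrightarrow> r < M \<Longrightarrow> i' < n \<Longrightarrow> G i r (flip_row i' x) = (if i' = i then - G i r x else G i r x)"
  shows "\<exists>x\<in>sphere_rows n (\<lambda>i. M + i). (\<forall>i<n. \<forall>r<M. G i r x = 0) \<and>
    (\<forall>i<n. \<forall>j<n. i \<noteq> j \<longrightarrow> (\<Sum>t<M + n. x i t * x j t) = 0)"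
proof -
  define ip where "ip i j x = (\<Sum>t<M + n. x i t * x j t)" for i j and x :: "nat \<Rightarrow> nat \<Rightarrow> real"
  define fs where "fs = concat (map (\<lambda>i. map (\<lambda>r. (G i r, {i})) [0..<M] @ map (\<lambda>j. (ip i j, {i, j})) [Suc i..<n]) [0..<n])"
  have set_fs: "set fs = (\<Union>i\<in>{..<n}. (\<lambda>r. (G i r, {i})) ` {..<M} \<union> (\<lambda>j. (ip i j, {i, j})) ` {i<..<n})"
    by (simp only: fs_def set_concat set_map image_image set_append set_upt lessThan_atLeast0
        atLeastSucLessThan_greaterThanLessThan)
  have "map snd fs = concat (map (\<lambda>i. replicate M {i} @ map (\<lambda>j. {i, j}) [Suc i..<n]) [0..<n])"
    by (simp add: fs_def map_concat o_def map_replicate_const)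
  then have forced: "forced n (\<lambda>i. M + i) (map snd fs)"
    using forced_flag[of 0 n M] by simp
  have split: "(\<exists>i r. f = G i r \<and> \<kappa> = {i} \<and> i < n \<and> r < M) \<or> (\<exists>i j. f = ip i j \<and> \<kappa> = {i, j} \<and> i < j \<and> j < n)"
    if "(f, \<kappa>) \<in> set fs" for f \<kappa>
  proof -
    from that obtain i where "i < n" and "(f, \<kappa>) \<in> (\<lambda>r. (G i r, {i})) ` {..<M} \<or> (f, \<kappa>) \<in> (\<lambda>j. (ip i j, {i, j})) ` {i<..<n}"
      unfolding set_fs by blast
    then show ?thesis
    proof (elim disjE imageE)
      fix r assume "(f, \<kappa>) = (G i r, {i})" "r \<in> {..<M}"
      with \<open>i < n\<close> have "f = G i r \<and> \<kappa> = {i} \<and> i < n \<and> r < M"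
        by simp
      then show ?thesis
        by (intro disjI1 exI)
    next
      fix j assume "(f, \<kappa>) = (ip i j, {i, j})" "j \<in> {i<..<n}"
      then have "f = ip i j \<and> \<kappa> = {i, j} \<and> i < j \<and> j < n"
        by simp
      then show ?thesis
        by (intro disjI2 exI)
    qed
  qed
  have "continuous_on (sphere_rows n (\<lambda>i. M + i)) f" if "(f, \<kappa>) \<in> set fs" for f \<kappa>
  proof -
    have "continuous_on (sphere_rows n (\<lambda>i. M + i)) (ip i j)" for i j
      unfolding ip_def[abs_def] by (intro continuous_intros)
    then show ?thesis
      using split[OF that] cont by auto
  qed
  moreover have "f (flip_row i x) = (if i \<in> \<kappa> then - f x else f x)" if f: "(f, \<kappa>) \<in> set fs" and "i < n" for f \<kappa> x i
  proof -
    from split[OF f] consider (G) j r where "f = G j r" "\<kappa> = {j}" "j < n" "r < M"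
      | (ip) j l where "f = ip j l" "\<kappa> = {j, l}" "j < l" "l < n"
      by auto
    then show ?thesis
    proof cases
      case G
      then show ?thesis
        using odd[of j r i x] that(2) by auto
    next
      case ip
      then show ?thesis
        by (auto simp: ip_def flip_row_def sum_negf)
    qed
  qed
  ultimately have "\<exists>x\<in>sphere_rows n (\<lambda>i. M + i). \<forall>(f, \<kappa>)\<in>set fs. f x = 0"
    using forced by (intro equivariant_common_zero) auto
  then obtain x where x: "x \<in> sphere_rows n (\<lambda>i. M + i)" and zero: "\<And>f \<kappa>. (f, \<kappa>) \<in> set fs \<Longrightarrow> f x = 0"
    by blast
  have "G i r x = 0" if "i < n" "r < M" for i r
    using that by (intro zero[of "G i r" "{i}"], unfold set_fs, intro UN_I[of i] UnI1 imageI) auto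
  moreover have "ip i j x = 0" if "i < j" "j < n" for i j
    using that by (intro zero[of "ip i j" "{i, j}"], unfold set_fs, intro UN_I[of i] UnI2 imageI) auto
  moreover have "ip i j x = ip j i x" for i j
    by (simp add: ip_def mult.commute)
  ultimately have "\<forall>i<n. \<forall>r<M. G i r x = 0" and "\<forall>i<n. \<forall>j<n. i \<noteq> j \<longrightarrow> ip i j x = 0"
    by (simp, metis linorder_neqE_nat)
  then show ?thesis
    using x unfolding ip_def by blast
qed

section \<open>Center points and their semicontinuity\<close>

text \<open>A continuous majorant of the indicator function of \<open>t \<ge> 0\<close>, which decreases to it as \<open>\<delta>\<close> tends to zero.\<close>

definition ramp :: "real \<Rightarrow> real \<Rightarrow> real" where
  "ramp \<delta> t = max 0 (min 1 (1 + t / \<delta>))"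

lemma ramp_bounds: "0 \<le> ramp \<delta> t" "ramp \<delta> t \<le> 1"
  by (auto simp: ramp_def)

lemma ramp_ge_indicator: "\<delta> > 0 \<Longrightarrow> t \<ge> 0 \<Longrightarrow> ramp \<delta> t = 1"
  by (auto simp: ramp_def)

lemma ramp_eq_0: "\<delta> > 0 \<Longrightarrow> t \<le> - \<delta> \<Longrightarrow> ramp \<delta> t = 0"
  by (auto simp: ramp_def field_simps)

lemma ramp_mono: "0 < \<delta> \<Longrightarrow> \<delta> \<le> \<delta>' \<Longrightarrow> ramp \<delta> t \<le> ramp \<delta>' t"
proof -
  assume d: "0 < \<delta>" "\<delta> \<le> \<delta>'"
  show ?thesis
  proof (cases "t \<ge> 0")
    case False
    then have "t / \<delta> \<le> t / \<delta>'"
      using d by (intro divide_left_mono_neg) auto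
    then show ?thesis
      by (auto simp: ramp_def)
  qed (use d ramp_ge_indicator in auto)
qed

lemma continuous_on_ramp [continuous_intros]:
  "continuous_on S f \<Longrightarrow> continuous_on S (\<lambda>x. ramp \<delta> (f x))"
  unfolding ramp_def by (auto simp: divide_inverse intro!: continuous_intros)

lemma (in prob_space) continuous_on_integral_bounded:
  fixes g :: "'x::metric_space \<Rightarrow> 'a \<Rightarrow> real"
  assumes [measurable]: "\<And>x. g x \<in> borel_measurable M"
    and bound: "\<And>x p. \<bar>g x p\<bar> \<le> 1"
    and cont: "\<And>p. continuous_on S (\<lambda>x. g x p)"
  shows "continuous_on S (\<lambda>x. \<integral>p. g x p \<partial>M)"
  unfolding continuous_on_sequentially
proof (intro allI ballI impI)
  fix x a assume "a \<in> S" and x: "(\<forall>n. x n \<in> S) \<and> x \<longlonglongrightarrow> a"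
  then have "(\<lambda>n. g (x n) p) \<longlonglongrightarrow> g a p" for p
    using cont[of p] unfolding continuous_on_sequentially o_def by blast
  then have "(\<lambda>n. \<integral>p. g (x n) p \<partial>M) \<longlonglongrightarrow> (\<integral>p. g a p \<partial>M)"
    using bound by (intro integral_dominated_convergence[where w = "\<lambda>_. 1"]) auto
  then show "((\<lambda>x. \<integral>p. g x p \<partial>M) \<circ> x) \<longlonglongrightarrow> (\<integral>p. g a p \<partial>M)"
    by (simp add: o_def)
qed

lemma (in prob_space) integrable_ramp:
  assumes [measurable]: "g \<in> borel_measurable M"
  shows "integrable M (\<lambda>p. ramp \<delta> (g p))"
proof (rule integrable_const_bound[where B = 1])
  show "(\<lambda>p. ramp \<delta> (g p)) \<in> borel_measurable M"
    unfolding ramp_def by measurable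
qed (auto simp: ramp_bounds)

lemma (in prob_space) prob_le_integral_ramp:
  assumes [measurable]: "g \<in> borel_measurable M" and "\<delta> > 0"
  shows "prob {p\<in>space M. g p \<ge> 0} \<le> (\<integral>p. ramp \<delta> (g p) \<partial>M)"
proof -
  have "prob {p\<in>space M. g p \<ge> 0} = (\<integral>p. indicator {p\<in>space M. g p \<ge> 0} p \<partial>M)"
    by simp
  also have "\<dots> \<le> (\<integral>p. ramp \<delta> (g p) \<partial>M)"
  proof (rule integral_mono)
    show "integrable M (indicator {p\<in>space M. g p \<ge> 0} :: 'a \<Rightarrow> real)"
      by (rule integrable_const_bound[where B = 1]) auto
  qed (use assms in \<open>auto simp: indicator_def ramp_bounds ramp_ge_indicator intro: integrable_ramp\<close>)
  finally show ?thesis .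
qed

text \<open>Upper semicontinuity of the mass of closed half-spaces. The limit is taken first with a fixed width \<open>\<epsilon>\<close> of the ramp,
which dominates the narrower ramps, and then for \<open>\<epsilon>\<close> tending to zero.\<close>

lemma (in prob_space) prob_ge_limit:
  fixes g :: "nat \<Rightarrow> 'a \<Rightarrow> real"
  assumes [measurable]: "\<And>r. g r \<in> borel_measurable M" "g' \<in> borel_measurable M"
    and lim: "\<And>p. (\<lambda>r. g r p) \<longlonglongrightarrow> g' p"
    and pos: "\<And>r. \<delta> r > 0" and "\<delta> \<longlonglongrightarrow> 0"
    and ge: "eventually (\<lambda>r. (\<integral>p. ramp (\<delta> r) (g r p) \<partial>M) \<ge> c) sequentially"
  shows "prob {p\<in>space M. g' p \<ge> 0} \<ge> c"
proof -
  have meas [measurable]: "(\<lambda>p. ramp \<epsilon> (f p)) \<in> borel_measurable M" if "f \<in> borel_measurable M" for \<epsilon> f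
    using that unfolding ramp_def by measurable
  have *: "(\<integral>p. ramp \<epsilon> (g' p) \<partial>M) \<ge> c" if "\<epsilon> > 0" for \<epsilon>
  proof -
    have "(\<lambda>r. ramp \<epsilon> (g r p)) \<longlonglongrightarrow> ramp \<epsilon> (g' p)" for p
      using that lim[of p] unfolding ramp_def by (auto intro!: tendsto_intros)
    then have "(\<lambda>r. \<integral>p. ramp \<epsilon> (g r p) \<partial>M) \<longlonglongrightarrow> (\<integral>p. ramp \<epsilon> (g' p) \<partial>M)"
      using ramp_bounds by (intro integral_dominated_convergence[where w = "\<lambda>_. 1"]) auto
    moreover have "eventually (\<lambda>r. \<delta> r < \<epsilon>) sequentially"
      using \<open>\<delta> \<longlonglongrightarrow> 0\<close> that by (rule order_tendstoD)
    with ge have "eventually (\<lambda>r. (\<integral>p. ramp \<epsilon> (g r p) \<partial>M) \<ge> c) sequentially"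
    proof eventually_elim
      case (elim r)
      have "(\<integral>p. ramp (\<delta> r) (g r p) \<partial>M) \<le> (\<integral>p. ramp \<epsilon> (g r p) \<partial>M)"
        using elim pos[of r] by (intro integral_mono integrable_ramp ramp_mono) auto
      with elim show ?case by simp
    qed
    ultimately show ?thesis
      by (intro tendsto_lowerbound) auto
  qed
  let ?I = "indicator {p\<in>space M. g' p \<ge> 0} :: 'a \<Rightarrow> real"
  have "(\<lambda>r. ramp (1 / real (Suc r)) (g' p)) \<longlonglongrightarrow> ?I p" if p: "p \<in> space M" for p
  proof (cases "g' p \<ge> 0")
    case True
    then show ?thesis
      using p by (simp add: ramp_ge_indicator)
  next
    case False
    have "(\<lambda>r. 1 / real (Suc r)) \<longlonglongrightarrow> 0"
      by (rule LIMSEQ_Suc[OF lim_const_over_n])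
    then have "eventually (\<lambda>r. 1 / real (Suc r) < - g' p) sequentially"
      by (rule order_tendstoD) (use False in simp)
    then have "eventually (\<lambda>r. ramp (1 / real (Suc r)) (g' p) = ?I p) sequentially"
    proof eventually_elim
      case (elim r)
      then have "ramp (1 / real (Suc r)) (g' p) = 0"
        by (intro ramp_eq_0) auto
      then show ?case
        using False by simp
    qed
    then show ?thesis
      by (rule tendsto_eventually)
  qed
  then have "(\<lambda>r. \<integral>p. ramp (1 / real (Suc r)) (g' p) \<partial>M) \<longlonglongrightarrow> (\<integral>p. ?I p \<partial>M)"
    using ramp_bounds by (intro integral_dominated_convergence[where w = "\<lambda>_. 1"]) auto
  then have "(\<integral>p. ?I p \<partial>M) \<ge> c"
    using * by (intro tendsto_lowerbound) auto
  then show ?thesis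
    by simp
qed

text \<open>The center point argument. If some weight were positive, then \<open>0\<close> would be a convex combination of at most
\<open>D + 1\<close> directions \<open>B\<close> of positive weight, by Caratheodory's theorem. At no point can \<open>q p \<bullet> B\<close> be
negative for all of them, so that their half-spaces cover the space, although their masses sum to less than one.\<close>

lemma (in prob_space) weighted_center:
  fixes q :: "'a \<Rightarrow> 'b::euclidean_space"
  assumes q: "q \<in> borel_measurable M"
    and N: "finite N" "N \<subseteq> Z" "int (dim Z) \<le> int D"
    and w: "\<And>B. B \<in> N \<Longrightarrow> w B \<ge> 0" "(\<Sum>B\<in>N. w B *\<^sub>R B) = 0"
    and bad: "\<And>B. B \<in> N \<Longrightarrow> w B > 0 \<Longrightarrow> prob {p\<in>space M. q p \<bullet> B \<ge> 0} < 1 / (real D + 1)"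
    and "B0 \<in> N"
  shows "w B0 = 0"
proof (rule ccontr)
  assume "w B0 \<noteq> 0"
  define S where "S = {B\<in>N. w B > 0}"
  have S: "finite S" "B0 \<in> S" "S \<subseteq> N"
    using \<open>w B0 \<noteq> 0\<close> w(1)[OF \<open>B0 \<in> N\<close>] \<open>B0 \<in> N\<close> N(1) by (auto simp: S_def)
  define W where "W = sum w S"
  have "W > 0"
    unfolding W_def using S by (intro sum_pos2[of _ B0]) (auto simp: S_def)
  have "(\<Sum>B\<in>S. w B *\<^sub>R B) = 0"
    using w N(1) by (subst w(2)[symmetric]) (rule sum.mono_neutral_left, auto simp: S_def less_le)
  then have "(\<Sum>B\<in>S. (w B / W) *\<^sub>R B) = 0"
    by (simp add: divide_inverse mult.commute scaleR_scaleR[symmetric] scaleR_sum_right[symmetric] del: scaleR_scaleR)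
  moreover have "(\<Sum>B\<in>S. w B / W) = 1"
    using \<open>W > 0\<close> by (simp add: W_def flip: sum_divide_distrib)
  ultimately have "0 \<in> convex hull S"
    using S(1) \<open>W > 0\<close> by (auto simp: convex_hull_finite S_def intro!: exI[of _ "\<lambda>B. w B / W"])
  then obtain T where T: "finite T" "T \<subseteq> S" "int (card T) \<le> aff_dim S + 1" "0 \<in> convex hull T"
    unfolding caratheodory_aff_dim[of S] by auto
  have "aff_dim S \<le> int (dim Z)"
    using aff_dim_subset[of S "span Z"] aff_dim_subspace[of "span Z"] S(3) N(2) span_superset[of Z]
    by (simp add: dim_span)
  then have card: "real (card T) \<le> real D + 1"
    using T(3) N(3) by linarith
  obtain u where u: "\<And>B. B \<in> T \<Longrightarrow> u B \<ge> 0" "sum u T = 1" "(\<Sum>B\<in>T. u B *\<^sub>R B) = 0"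
    using T(4) unfolding convex_hull_finite[OF T(1)] by auto
  have "T \<noteq> {}"
    using u(2) by auto
  have meas: "{p\<in>space M. q p \<bullet> B \<ge> 0} \<in> events" for B
    using q by measurable
  have "space M \<subseteq> (\<Union>B\<in>T. {p\<in>space M. q p \<bullet> B \<ge> 0})"
  proof
    fix p assume p: "p \<in> space M"
    show "p \<in> (\<Union>B\<in>T. {p\<in>space M. q p \<bullet> B \<ge> 0})"
    proof (rule ccontr)
      assume "\<not> ?thesis"
      then have neg: "q p \<bullet> B < 0" if "B \<in> T" for B
        using p that by force
      have "\<exists>B\<in>T. u B \<noteq> 0"
        using u(2) by (metis sum.neutral zero_neq_one)
      then obtain B1 where "B1 \<in> T" "u B1 > 0"
        using u(1) by force
      then have "(\<Sum>B\<in>T. u B * (q p \<bullet> B)) < 0"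
        using neg u(1) T(1) sum_strict_mono_ex1[of T "\<lambda>B. u B * (q p \<bullet> B)" "\<lambda>_. 0"] by (force simp: mult_le_0_iff mult_less_0_iff less_imp_le)
      moreover have "(\<Sum>B\<in>T. u B * (q p \<bullet> B)) = q p \<bullet> (\<Sum>B\<in>T. u B *\<^sub>R B)"
        by (simp add: inner_sum_right)
      ultimately show False
        using u(3) by simp
    qed
  qed
  then have "1 \<le> prob (\<Union>B\<in>T. {p\<in>space M. q p \<bullet> B \<ge> 0})"
    using meas T(1) by (subst prob_space[symmetric], intro finite_measure_mono) auto
  also have "\<dots> \<le> (\<Sum>B\<in>T. prob {p\<in>space M. q p \<bullet> B \<ge> 0})"
    using meas T(1) by (intro finite_measure_subadditive_finite) auto
  also have "\<dots> < (\<Sum>B\<in>T. 1 / (real D + 1))"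
    using T \<open>T \<noteq> {}\<close> bad by (intro sum_strict_mono) (auto simp: S_def)
  also have "\<dots> \<le> 1"
    using card by (simp add: field_simps)
  finally show False by simp
qed

section \<open>Bilinear forms on projective space\<close>

definition unit_rep :: "'n::finite rproj \<Rightarrow> real ^ 'n" where
  "unit_rep p = (SOME x. x \<in> line_of p \<and> norm x = 1)"

lemma unit_rep_in_line: "unit_rep p \<in> line_of p" and norm_unit_rep: "norm (unit_rep p) = 1"
proof -
  have "\<not> line_of p \<subseteq> {0}"
    using dim_line_of[of p] dim_eq_0[of "line_of p"] by simp
  then obtain x where x: "x \<in> line_of p" "x \<noteq> 0"
    by blast
  then have "(1 / norm x) *\<^sub>R x \<in> line_of p \<and> norm ((1 / norm x) *\<^sub>R x) = 1"
    using subspace_line_of[of p] by (simp add: subspace_scale)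
  then have "unit_rep p \<in> line_of p \<and> norm (unit_rep p) = 1"
    unfolding unit_rep_def by (rule someI)
  then show "unit_rep p \<in> line_of p" "norm (unit_rep p) = 1"
    by auto
qed

lemma line_of_eq_span_unit_rep: "line_of p = span {unit_rep p}"
  using norm_unit_rep[of p] by (intro line_of_eq_span unit_rep_in_line) auto

lemma normalize_in_line:
  assumes "x \<in> line_of p" "x \<noteq> 0"
  shows "(1 / norm x) *\<^sub>R x = unit_rep p \<or> (1 / norm x) *\<^sub>R x = - unit_rep p"
proof -
  obtain c where c: "x = c *\<^sub>R unit_rep p"
    using assms(1) unfolding line_of_eq_span_unit_rep by (auto simp: span_singleton)
  then have "c \<noteq> 0"
    using assms(2) by auto
  with c show ?thesis
    by (cases "c > 0") (auto simp: norm_unit_rep)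
qed

text \<open>The choice between the two opposite unit vectors on a line is not continuous, but an even function
does not see it.\<close>

lemma continuous_on_even_unit_rep:
  fixes q :: "real ^ 'n::finite \<Rightarrow> 'b::topological_space"
  assumes cont: "continuous_on UNIV q" and even: "\<And>x. q (- x) = q x"
  shows "continuous_on UNIV (\<lambda>p. q (unit_rep p))"
  unfolding continuous_on_open_vimage[OF open_UNIV]
proof (intro allI impI)
  fix O' :: "'b set" assume "open O'"
  let ?N = "\<lambda>x :: real ^ 'n. (1 / norm x) *\<^sub>R x"
  have "continuous_on (- {0}) (\<lambda>x. q (?N x))"
    by (rule continuous_on_compose2[OF cont]) (auto intro!: continuous_intros)
  then have "open ((\<lambda>x. q (?N x)) -` O' \<inter> - {0})"
    using \<open>open O'\<close> by (simp add: continuous_on_open_vimage open_Compl)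
  also have "(\<lambda>x. q (?N x)) -` O' \<inter> - {0} = {x. x \<noteq> 0 \<and> (\<exists>p\<in>(\<lambda>p. q (unit_rep p)) -` O'. x \<in> line_of p)}"
  proof -
    have "q (?N x) = q (unit_rep p)" if "x \<in> line_of p" "x \<noteq> 0" for x p
      using normalize_in_line[OF that] even by auto
    then show ?thesis
      using ex_line_of by fastforce
  qed
  finally show "open ((\<lambda>p. q (unit_rep p)) -` O' \<inter> UNIV)"
    by (simp add: open_rproj_def)
qed

text \<open>The matrix \<open>\<Lambda>v \<otimes> Av\<close>. It is even in \<open>v\<close> and therefore a function on projective space.\<close>

definition outer :: "real ^ 'n ^ 'n \<Rightarrow> real ^ 'n ^ 'n \<Rightarrow> real ^ 'n::finite \<Rightarrow> real ^ 'n ^ 'n" where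
  "outer \<Lambda> A v = (\<chi> a b. (\<Lambda> *v v) $ a * (A *v v) $ b)"

lemma outer_minus: "outer \<Lambda> A (- v) = outer \<Lambda> A v"
  by (simp add: outer_def vec_eq_iff matrix_vector_mult_def sum_negf)

lemma inner_outer: "outer \<Lambda> A v \<bullet> B = (\<Sum>a\<in>UNIV. \<Sum>b\<in>UNIV. (\<Lambda> *v v) $ a * (A *v v) $ b * B $ a $ b)"
  by (simp add: inner_vec_def outer_def)

lemma continuous_on_outer_unit_rep: "continuous_on UNIV (\<lambda>p. outer \<Lambda> A (unit_rep p))"
proof (rule continuous_on_even_unit_rep)
  show "continuous_on UNIV (outer \<Lambda> A)"
    unfolding outer_def[abs_def] matrix_vector_mult_def by (auto intro!: continuous_intros)
qed (rule outer_minus)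

lemma dim_block_matrices:
  fixes e :: "'n::finite \<Rightarrow> nat"
  assumes "inj e"
  shows "dim {B :: real ^ 'n ^ 'n. \<forall>a b. \<not> (e a < k \<and> e b < n) \<longrightarrow> B $ a $ b = 0} \<le> k * n"
proof -
  let ?W = "(\<lambda>(a, b). axis a (axis b 1) :: real ^ 'n ^ 'n) ` ({a. e a < k} \<times> {b. e b < n})"
  have card: "card {a. e a < l} \<le> l" for l
  proof -
    have "card {a. e a < l} = card (e ` {a. e a < l})"
      using assms by (metis card_image inj_on_subset subset_UNIV)
    also have "\<dots> \<le> card {..<l}"
      by (intro card_mono) auto
    finally show ?thesis by simp
  qed
  have "dim {B :: real ^ 'n ^ 'n. \<forall>a b. \<not> (e a < k \<and> e b < n) \<longrightarrow> B $ a $ b = 0} \<le> card ?W"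
  proof (rule dim_le_card)
    show "{B :: real ^ 'n ^ 'n. \<forall>a b. \<not> (e a < k \<and> e b < n) \<longrightarrow> B $ a $ b = 0} \<subseteq> span ?W"
    proof
      fix B :: "real ^ 'n ^ 'n"
      assume "B \<in> {B. \<forall>a b. \<not> (e a < k \<and> e b < n) \<longrightarrow> B $ a $ b = 0}"
      then have B: "B $ a $ b = 0" if "\<not> (e a < k \<and> e b < n)" for a b
        using that by blast
      have "(\<Sum>b\<in>Basis. (B \<bullet> b) *\<^sub>R b) \<in> span ?W"
      proof (rule span_sum)
        fix u :: "real ^ 'n ^ 'n" assume "u \<in> Basis"
        then obtain a b where u: "u = axis a (axis b 1)"
          by (auto simp: Basis_vec_def)
        show "(B \<bullet> u) *\<^sub>R u \<in> span ?W"
        proof (cases "e a < k \<and> e b < n")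
          case True
          then have "u \<in> ?W"
            unfolding u by (intro image_eqI[of _ _ "(a, b)"]) auto
          then show ?thesis
            by (intro span_scale span_base)
        next
          case False
          then show ?thesis
            using B by (simp add: u inner_axis span_zero)
        qed
      qed
      then show "B \<in> span ?W"
        by (simp add: euclidean_representation)
    qed
  qed simp
  also have "\<dots> \<le> card ({a. e a < k} \<times> {b. e b < n})"
    by (rule card_image_le) simp
  also have "\<dots> \<le> k * n"
    unfolding card_cartesian_product by (intro mult_le_mono card)
  finally show ?thesis .
qed

text \<open>The enumeration \<open>e\<close> of the index type turns an array of numbers into a matrix, of which only the first \<open>n\<close>
rows are used.\<close>

definition frame :: "('n::finite \<Rightarrow> nat) \<Rightarrow> nat \<Rightarrow> (nat \<Rightarrow> nat \<Rightarrow> real) \<Rightarrow> real ^ 'n ^ 'n" where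
  "frame e n x = (\<chi> a b. if e a < n then x (e a) (e b) else 0)"

lemma frame_mult: "(frame e n x *v v) $ b = (\<Sum>c\<in>UNIV. (if e b < n then x (e b) (e c) else 0) * v $ c)"
  by (simp add: frame_def matrix_vector_mult_def)

lemma frame_flip_row:
  assumes "i < n"
  shows "(frame e n (flip_row i x) *v v) $ b = (if e b = i then - (frame e n x *v v) $ b else (frame e n x *v v) $ b)"
  using assms by (auto simp: frame_mult flip_row_def simp flip: sum_negf intro!: sum.cong)

definition neg_col :: "('n::finite \<Rightarrow> nat) \<Rightarrow> nat \<Rightarrow> real ^ 'n ^ 'n \<Rightarrow> real ^ 'n ^ 'n" where
  "neg_col e i B = (\<chi> a b. if e b = i then - B $ a $ b else B $ a $ b)"

lemma neg_col_neg_col [simp]: "neg_col e i (neg_col e i B) = B"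
  by (simp add: neg_col_def vec_eq_iff)

text \<open>The pairing is bilinear, so a sign can be moved from a row of the frame to the matching column of \<open>B\<close>. This makes
the equations for a central frame odd.\<close>

lemma inner_outer_flip_row:
  assumes "i < n"
  shows "outer \<Lambda> (frame e n (flip_row i x)) v \<bullet> B = outer \<Lambda> (frame e n x) v \<bullet> neg_col e i B"
  unfolding inner_outer frame_flip_row[OF assms] by (intro sum.cong refl) (simp add: neg_col_def)

text \<open>A finite set of test directions, supported on the first \<open>k\<close> rows and \<open>n\<close> columns. It is invariant
under sign changes of columns, and every such matrix is a limit of elements of these sets as \<open>r\<close> grows.\<close>

definition net :: "('n::finite \<Rightarrow> nat) \<Rightarrow> nat \<Rightarrow> nat \<Rightarrow> nat \<Rightarrow> (real ^ 'n ^ 'n) set" where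
  "net e k n r = {B. \<forall>a b. B $ a $ b \<in>
     (if e a < k \<and> e b < n then (\<lambda>z. real_of_int z / real r) ` {- (int r)\<^sup>2..(int r)\<^sup>2} else {0})}"

lemma finite_net: "finite (net e k n r :: (real ^ 'n::finite ^ 'n) set)"
proof -
  let ?S = "insert 0 ((\<lambda>z. real_of_int z / real r) ` {- (int r)\<^sup>2..(int r)\<^sup>2})"
  let ?F = "PiE UNIV (\<lambda>_::'n. PiE UNIV (\<lambda>_::'n. ?S))"
  have "finite ?F"
    by (intro finite_PiE) auto
  moreover have "net e k n r \<subseteq> (\<lambda>f. \<chi> a b. f a b) ` ?F"
  proof
    fix B :: "real ^ 'n ^ 'n" assume B: "B \<in> net e k n r"
    have "B $ a $ b \<in> ?S" for a b
      using B unfolding net_def by (auto split: if_splits)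
    then have "(\<lambda>a b. B $ a $ b) \<in> ?F"
      by (simp add: PiE_iff)
    then show "B \<in> (\<lambda>f. \<chi> a b. f a b) ` ?F"
      by (intro image_eqI[of _ _ "\<lambda>a b. B $ a $ b"]) (auto simp: vec_eq_iff)
  qed
  ultimately show ?thesis
    using finite_surj by blast
qed

lemma neg_col_net: "B \<in> net e k n r \<Longrightarrow> neg_col e i B \<in> net e k n r"
proof -
  assume B: "B \<in> net e k n r"
  let ?S = "(\<lambda>z. real_of_int z / real r) ` {- (int r)\<^sup>2..(int r)\<^sup>2}"
  have "- t \<in> ?S" if "t \<in> ?S" for t
  proof -
    from that obtain z where "t = real_of_int z / real r" "z \<in> {- (int r)\<^sup>2..(int r)\<^sup>2}"
      by blast
    then show ?thesis
      by (intro image_eqI[of _ _ "- z"]) auto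
  qed
  then show ?thesis
    using B unfolding net_def neg_col_def by (auto split: if_splits)
qed

definition round_to_net :: "('n::finite \<Rightarrow> nat) \<Rightarrow> nat \<Rightarrow> nat \<Rightarrow> nat \<Rightarrow> real ^ 'n ^ 'n \<Rightarrow> real ^ 'n ^ 'n" where
  "round_to_net e k n r B = (\<chi> a b. if e a < k \<and> e b < n then real_of_int \<lfloor>real r * B $ a $ b\<rfloor> / real r else 0)"

lemma round_in_net:
  assumes "r > 0" and "\<And>a b. \<bar>B $ a $ b\<bar> + 1 \<le> real r"
  shows "round_to_net e k n r B \<in> net e k n r"
proof -
  have "\<lfloor>real r * B $ a $ b\<rfloor> \<in> {- (int r)\<^sup>2..(int r)\<^sup>2}" for a b
  proof -
    have "\<bar>real r * B $ a $ b\<bar> + 1 \<le> real r * \<bar>B $ a $ b\<bar> + real r"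
      using assms(1) by (simp add: abs_mult)
    also have "\<dots> = real r * (\<bar>B $ a $ b\<bar> + 1)"
      by (simp add: algebra_simps)
    also have "\<dots> \<le> real r * real r"
      using assms by (intro mult_left_mono) auto
    finally have "\<bar>real r * B $ a $ b\<bar> + 1 \<le> real_of_int ((int r)\<^sup>2)"
      by (simp add: power2_eq_square)
    then show ?thesis
      by (auto simp: le_floor_iff floor_le_iff)
  qed
  then show ?thesis
    by (auto simp: net_def round_to_net_def)
qed

lemma round_to_net_tendsto:
  assumes "e a < k" "e b < n" "filterlim r at_top sequentially"
  shows "(\<lambda>s. round_to_net e k n (r s) B $ a $ b) \<longlonglongrightarrow> B $ a $ b"
proof -
  have "(\<lambda>s. 1 / real (r s)) \<longlonglongrightarrow> 0"
    using filterlim_compose[OF lim_1_over_n assms(3)] .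
  moreover have "\<forall>\<^sub>F s in sequentially. norm (round_to_net e k n (r s) B $ a $ b - B $ a $ b) \<le> 1 / real (r s)"
    using eventually_compose_filterlim[OF eventually_gt_at_top[of 0] assms(3)]
  proof eventually_elim
    case (elim s)
    let ?R = "real (r s)" and ?t = "B $ a $ b"
    have "round_to_net e k n (r s) B $ a $ b - ?t = (real_of_int \<lfloor>?R * ?t\<rfloor> - ?R * ?t) / ?R"
      using assms elim by (simp add: round_to_net_def field_simps)
    moreover have "\<bar>real_of_int \<lfloor>?R * ?t\<rfloor> - ?R * ?t\<bar> \<le> 1"
      by linarith
    ultimately show ?case
      using elim by (simp add: divide_right_mono)
  qed
  ultimately have "(\<lambda>s. round_to_net e k n (r s) B $ a $ b - B $ a $ b) \<longlonglongrightarrow> 0"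
    by (rule Lim_null_comparison[rotated])
  then show ?thesis
    by (simp add: LIM_zero_iff)
qed

section \<open>A central frame\<close>

text \<open>The sum \<open>F j x\<close> of the test directions, weighted by how much their half-spaces fall short of the required
mass, depends continuously on the frame \<open>x\<close>, and changing the sign of row \<open>i\<close> of the frame changes the sign of
column \<open>i\<close> of \<open>F j x\<close>. A frame where all these sums vanish has no deficient test direction.\<close>

theorem central_frame_approx:
  fixes \<mu> :: "nat \<Rightarrow> 'n::finite rproj measure" and \<Lambda> :: "real ^ 'n ^ 'n" and e :: "'n \<Rightarrow> nat"
  assumes e: "bij_betw e UNIV {..<CARD('n)}" and card: "CARD('n) = m * k + n"
    and prob: "\<And>j. j < m \<Longrightarrow> prob_space (\<mu> j)" and borel: "\<And>j. j < m \<Longrightarrow> sets (\<mu> j) = sets borel"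
    and "\<delta> > 0"
  shows "\<exists>x\<in>sphere_rows n (\<lambda>i. m * k + i).
    (\<forall>i<n. \<forall>j<n. i \<noteq> j \<longrightarrow> (\<Sum>t<m * k + n. x i t * x j t) = 0) \<and>
    (\<forall>j<m. \<forall>B\<in>net e k n r. 1 / (real (k * n) + 1) \<le> (\<integral>p. ramp \<delta> (outer \<Lambda> (frame e n x) (unit_rep p) \<bullet> B) \<partial>\<mu> j))"
proof -
  let ?X = "sphere_rows n (\<lambda>i. m * k + i)"
  let ?c = "1 / (real (k * n) + 1)"
  let ?N = "net e k n r :: (real ^ 'n ^ 'n) set"
  define idx where "idx = inv_into UNIV e"
  have inj: "inj e"
    using e by (rule bij_betw_imp_inj_on)
  have e_idx: "e (idx l) = l" if "l < CARD('n)" for l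
    unfolding idx_def using e that by (intro f_inv_into_f) (auto simp: bij_betw_def)
  have idx_e: "idx (e a) = a" for a
    unfolding idx_def by (rule inv_into_f_f[OF inj UNIV_I])
  define q where "q x p = outer \<Lambda> (frame e n x) (unit_rep p)" for x and p :: "'n rproj"
  define \<Phi> where "\<Phi> j x B = (\<integral>p. ramp \<delta> (q x p \<bullet> B) \<partial>\<mu> j)" for j x B
  \<comment> \<open>The weight is positive exactly for the directions whose smoothed half-space is too light.\<close>
  define w where "w j x B = max 0 (?c - \<Phi> j x B)" for j x B
  define F where "F j x = (\<Sum>B\<in>?N. w j x B *\<^sub>R B)" for j x
  have q_measurable [measurable]: "q x \<in> borel_measurable (\<mu> j)" if "j < m" for x j
  proof -
    have "q x \<in> borel_measurable borel"
      unfolding q_def[abs_def] by (intro borel_measurable_continuous_onI continuous_on_outer_unit_rep)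
    then show ?thesis
      using measurable_cong_sets[OF borel[OF that] refl] by blast
  qed
  have cont_q: "continuous_on S (\<lambda>x. q x p \<bullet> B)" for S p B
  proof -
    have "continuous_on S (\<lambda>x. if e b < n then x (e b) (e c) else 0 :: real)" for b c
      by (cases "e b < n") (auto intro: continuous_intros)
    then show ?thesis
      unfolding q_def inner_outer frame_mult by (intro continuous_intros)
  qed
  have cont_\<Phi>: "continuous_on S (\<lambda>x. \<Phi> j x B)" if "j < m" for S j B
  proof -
    interpret prob_space "\<mu> j"
      by (rule prob[OF that])
    show ?thesis
      unfolding \<Phi>_def
    proof (rule continuous_on_integral_bounded)
      show "(\<lambda>p. ramp \<delta> (q x p \<bullet> B)) \<in> borel_measurable (\<mu> j)" for x
        using q_measurable[OF that, of x] unfolding ramp_def by measurable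
      show "\<bar>ramp \<delta> (q x p \<bullet> B)\<bar> \<le> 1" for x p
        using ramp_bounds[of \<delta> "q x p \<bullet> B"] by simp
    qed (intro continuous_on_ramp cont_q)
  qed
  have cont_F: "continuous_on S (\<lambda>x. F j x $ a $ b)" if "j < m" for S j a b
    unfolding F_def w_def using that by (auto intro!: continuous_intros cont_\<Phi>)
  have flip: "F j (flip_row i x) $ a $ idx i' = (if i' = i then - F j x $ a $ idx i' else F j x $ a $ idx i')"
    if "i < n" "i' < n" for i i' j x a
  proof -
    have i': "e (idx i') = i'"
      using that card by (intro e_idx) simp
    have "w j (flip_row i x) B = w j x (neg_col e i B)" for B
      using that(1) by (simp add: w_def \<Phi>_def q_def inner_outer_flip_row)
    then have "F j (flip_row i x) $ a $ idx i' = (\<Sum>B\<in>?N. w j x (neg_col e i B) * B $ a $ idx i')"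
      by (simp add: F_def)
    also have "\<dots> = (\<Sum>B\<in>?N. w j x B * neg_col e i B $ a $ idx i')"
      by (rule sum.reindex_bij_witness[where i = "neg_col e i" and j = "neg_col e i"])
        (auto intro: neg_col_net)
    also have "\<dots> = (if i' = i then - F j x $ a $ idx i' else F j x $ a $ idx i')"
      by (simp add: F_def neg_col_def i' sum_negf)
    finally show ?thesis .
  qed
  let ?G = "\<lambda>i l x. F (l div k) x $ idx (l mod k) $ idx i"
  have div: "l div k < m" if "l < m * k" for l
    using that by (simp add: less_mult_imp_div_less)
  have "\<exists>x\<in>?X. (\<forall>i<n. \<forall>l<m * k. ?G i l x = 0) \<and>
      (\<forall>i<n. \<forall>j<n. i \<noteq> j \<longrightarrow> (\<Sum>t<m * k + n. x i t * x j t) = 0)"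
    by (rule Stiefel_common_zero) (use cont_F flip div in auto)
  then obtain x where x: "x \<in> ?X" and G: "\<And>i l. i < n \<Longrightarrow> l < m * k \<Longrightarrow> ?G i l x = 0"
    and orth: "\<forall>i<n. \<forall>j<n. i \<noteq> j \<longrightarrow> (\<Sum>t<m * k + n. x i t * x j t) = 0"
    by blast
  have F0: "F j x = 0" if j: "j < m" for j
  proof -
    have "F j x $ a $ b = 0" for a b
    proof (cases "e a < k \<and> e b < n")
      case True
      \<comment> \<open>The equations of one row are numbered by pairs of a measure and a row of \<open>\<Lambda>\<close>.\<close>
      let ?l = "j * k + e a"
      have "?l < j * k + k"
        using True by simp
      also have "\<dots> \<le> m * k"
        using j by (metis Suc_leI add.commute mult_Suc mult_le_mono1)
      finally have "?G (e b) ?l x = 0"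
        using G True by blast
      moreover have "?l div k = j" "?l mod k = e a"
        using True by auto
      ultimately show ?thesis
        by (simp add: idx_e)
    next
      case False
      have "B $ a $ b = 0" if "B \<in> ?N" for B
        using that False unfolding net_def by (auto split: if_splits)
      then show ?thesis
        by (simp add: F_def)
    qed
    then show ?thesis
      by (simp add: vec_eq_iff)
  qed
  have "?c \<le> \<Phi> j x B0" if j: "j < m" and B0: "B0 \<in> ?N" for j B0
  proof -
    interpret prob_space "\<mu> j"
      by (rule prob[OF j])
    have "w j x B0 = 0"
    proof (rule weighted_center[where w = "w j x" and N = ?N and q = "q x" and D = "k * n"
          and Z = "{B. \<forall>a b. \<not> (e a < k \<and> e b < n) \<longrightarrow> B $ a $ b = 0}"])
      show "q x \<in> borel_measurable (\<mu> j)"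
        by (rule q_measurable[OF j])
      show "?N \<subseteq> {B. \<forall>a b. \<not> (e a < k \<and> e b < n) \<longrightarrow> B $ a $ b = 0}"
        by (auto simp: net_def split: if_splits)
      show "int (dim {B :: real ^ 'n ^ 'n. \<forall>a b. \<not> (e a < k \<and> e b < n) \<longrightarrow> B $ a $ b = 0}) \<le> int (k * n)"
        using dim_block_matrices[OF inj, of k n] by (simp only: of_nat_le_iff)
      show "(\<Sum>B\<in>?N. w j x B *\<^sub>R B) = 0"
        using F0[OF j] by (simp add: F_def)
      show "prob {p \<in> space (\<mu> j). 0 \<le> q x p \<bullet> B} < ?c" if "B \<in> ?N" "0 < w j x B" for B
      proof -
        have "prob {p \<in> space (\<mu> j). 0 \<le> q x p \<bullet> B} \<le> \<Phi> j x B"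
          unfolding \<Phi>_def using q_measurable[OF j, of x] \<open>\<delta> > 0\<close> by (intro prob_le_integral_ramp) auto
        then show ?thesis
          using that by (simp add: w_def)
      qed
    qed (use B0 in \<open>auto simp: finite_net w_def\<close>)
    then show ?thesis
      by (simp add: w_def)
  qed
  then show ?thesis
    using x orth unfolding \<Phi>_def q_def by blast
qed

text \<open>Limits of approximately central frames, for ever finer nets and narrower ramps, are central.\<close>

theorem central_frame:
  fixes \<mu> :: "nat \<Rightarrow> 'n::finite rproj measure" and \<Lambda> :: "real ^ 'n ^ 'n" and e :: "'n \<Rightarrow> nat"
  assumes e: "bij_betw e UNIV {..<CARD('n)}" and card: "CARD('n) = m * k + n"
    and \<Lambda>: "\<And>a. k \<le> e a \<Longrightarrow> \<Lambda> $ a = 0"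
    and prob: "\<And>j. j < m \<Longrightarrow> prob_space (\<mu> j)" and borel: "\<And>j. j < m \<Longrightarrow> sets (\<mu> j) = sets borel"
  shows "\<exists>A :: real ^ 'n ^ 'n. (\<forall>a. n \<le> e a \<longrightarrow> A $ a = 0) \<and> (\<forall>a. e a < n \<longrightarrow> A $ a \<noteq> 0) \<and>
    (\<forall>a b. a \<noteq> b \<longrightarrow> A $ a \<bullet> A $ b = 0) \<and>
    (\<forall>j<m. \<forall>B. 1 / (real (k * n) + 1) \<le> measure (\<mu> j) {p. outer \<Lambda> A (unit_rep p) \<bullet> B \<ge> 0})"
proof -
  let ?X = "sphere_rows n (\<lambda>i. m * k + i)"
  let ?c = "1 / (real (k * n) + 1)"
  define P where "P r x \<longleftrightarrow> x \<in> ?X \<and> (\<forall>i<n. \<forall>j<n. i \<noteq> j \<longrightarrow> (\<Sum>t<m * k + n. x i t * x j t) = 0) \<and>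
    (\<forall>j<m. \<forall>B\<in>net e k n (Suc r). ?c \<le> (\<integral>p. ramp (1 / real (Suc r)) (outer \<Lambda> (frame e n x) (unit_rep p) \<bullet> B) \<partial>\<mu> j))"
    for r x
  have "\<exists>x. P r x" for r
  proof -
    have "0 < 1 / real (Suc r)"
      by simp
    from central_frame_approx[where \<mu> = \<mu> and r = "Suc r" and \<Lambda> = \<Lambda>, OF e card prob borel this]
    show ?thesis
      unfolding P_def by blast
  qed
  then obtain x where P: "\<And>r. P r (x r)"
    by metis
  then have x: "\<And>r. x r \<in> ?X"
    and orth: "\<And>r i j. i < n \<Longrightarrow> j < n \<Longrightarrow> i \<noteq> j \<Longrightarrow> (\<Sum>t<m * k + n. x r i t * x r j t) = 0"
    and ge: "\<And>r j B. j < m \<Longrightarrow> B \<in> net e k n (Suc r) \<Longrightarrow>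
      ?c \<le> (\<integral>p. ramp (1 / real (Suc r)) (outer \<Lambda> (frame e n (x r)) (unit_rep p) \<bullet> B) \<partial>\<mu> j)"
    unfolding P_def by blast+
  obtain x0 s where x0: "x0 \<in> ?X" and s: "strict_mono s" "(x \<circ> s) \<longlonglongrightarrow> x0"
    using compact_imp_seq_compact[OF compact_sphere_rows, of n "\<lambda>i. m * k + i"] x
    unfolding seq_compact_def by metis
  have lim: "(\<lambda>r. x (s r) i t) \<longlonglongrightarrow> x0 i t" for i t
    using continuous_on_tendsto_compose[OF continuous_on_entry[of UNIV i t] s(2)] by (simp add: o_def)
  let ?A = "frame e n x0"
  have A_row: "?A $ a = 0" if "n \<le> e a" for a
    using that by (simp add: frame_def vec_eq_iff)
  have e_less: "e a < m * k + n" for a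
    using bij_betwE[OF e] card by auto
  have ip: "?A $ a \<bullet> ?A $ b = (\<Sum>t<m * k + n. x0 (e a) t * x0 (e b) t)" if "e a < n" "e b < n" for a b
  proof -
    have "?A $ a \<bullet> ?A $ b = (\<Sum>c\<in>UNIV. x0 (e a) (e c) * x0 (e b) (e c))"
      using that by (simp add: frame_def inner_vec_def)
    also have "\<dots> = (\<Sum>t<m * k + n. x0 (e a) t * x0 (e b) t)"
      using sum.reindex_bij_betw[OF e] card by simp
    finally show ?thesis .
  qed
  have "?A $ a \<bullet> ?A $ b = 0" if "a \<noteq> b" for a b
  proof (cases "e a < n \<and> e b < n")
    case True
    have "e a \<noteq> e b"
      using that bij_betw_imp_inj_on[OF e] by (auto dest: injD)
    then have "(\<lambda>r. \<Sum>t<m * k + n. x (s r) (e a) t * x (s r) (e b) t) = (\<lambda>r. 0)"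
      using orth True by auto
    moreover have "(\<lambda>r. \<Sum>t<m * k + n. x (s r) (e a) t * x (s r) (e b) t)
        \<longlonglongrightarrow> (\<Sum>t<m * k + n. x0 (e a) t * x0 (e b) t)"
      by (intro tendsto_intros lim)
    ultimately have "(\<Sum>t<m * k + n. x0 (e a) t * x0 (e b) t) = 0"
      using LIMSEQ_const_iff by metis
    then show ?thesis
      using ip True by simp
  next
    case False
    then show ?thesis
      using A_row by (auto simp: not_less)
  qed
  moreover have "?A $ a \<noteq> 0" if a: "e a < n" for a
  proof
    assume "?A $ a = 0"
    have "x0 (e a) t = 0" if "t \<le> m * k + e a" for t
    proof -
      have "t \<in> e ` UNIV"
        using that a card bij_betw_imp_surj_on[OF e] by simp
      then obtain c where "t = e c"
        by blast
      then show ?thesis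
        using \<open>?A $ a = 0\<close> a by (simp add: frame_def vec_eq_iff)
    qed
    then have "(\<Sum>t\<le>m * k + e a. \<bar>x0 (e a) t\<bar>) = 0"
      by simp
    moreover have "(\<Sum>t\<le>m * k + e a. \<bar>x0 (e a) t\<bar>) = 1"
      using x0 a by (simp add: sphere_rows_def)
    ultimately show False
      by simp
  qed
  moreover have "?c \<le> measure (\<mu> j) {p. outer \<Lambda> ?A (unit_rep p) \<bullet> B \<ge> 0}" if j: "j < m" for j B
  proof -
    interpret prob_space "\<mu> j"
      by (rule prob[OF j])
    let ?R = "\<lambda>r. Suc (s r)"
    \<comment> \<open>Entries of \<open>B\<close> outside the block are replaced by \<open>0\<close>; they are paired with zero rows of \<open>\<Lambda>\<close> or of the frame.\<close>
    let ?B = "\<lambda>r. round_to_net e k n (?R r) B"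
    let ?g = "\<lambda>r p. outer \<Lambda> (frame e n (x (s r))) (unit_rep p) \<bullet> ?B r"
    have R: "filterlim ?R at_top sequentially"
      using filterlim_compose[OF filterlim_Suc filterlim_subseq[OF s(1)]] by simp
    have meas: "(\<lambda>p. outer \<Lambda> A (unit_rep p) \<bullet> C) \<in> borel_measurable (\<mu> j)" for A C
    proof -
      have "(\<lambda>p. outer \<Lambda> A (unit_rep p) \<bullet> C) \<in> borel_measurable borel"
        by (intro borel_measurable_continuous_onI continuous_intros continuous_on_outer_unit_rep)
      then show ?thesis
        using measurable_cong_sets[OF borel[OF j] refl] by blast
    qed
    have "prob {p\<in>space (\<mu> j). outer \<Lambda> ?A (unit_rep p) \<bullet> B \<ge> 0} \<ge> ?c"
    proof (rule prob_ge_limit[where g = ?g and \<delta> = "\<lambda>r. 1 / real (?R r)"])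
      show "?g r \<in> borel_measurable (\<mu> j)" for r
        by (rule meas)
      show "(\<lambda>p. outer \<Lambda> ?A (unit_rep p) \<bullet> B) \<in> borel_measurable (\<mu> j)"
        by (rule meas)
      show "(\<lambda>r. ?g r p) \<longlonglongrightarrow> outer \<Lambda> ?A (unit_rep p) \<bullet> B" for p
        unfolding inner_outer
      proof (intro tendsto_sum)
        fix a b
        show "(\<lambda>r. (\<Lambda> *v unit_rep p) $ a * (frame e n (x (s r)) *v unit_rep p) $ b * ?B r $ a $ b)
            \<longlonglongrightarrow> (\<Lambda> *v unit_rep p) $ a * (?A *v unit_rep p) $ b * B $ a $ b"
        proof (cases "e a < k \<and> e b < n")
          case True
          then have "(\<lambda>r. ?B r $ a $ b) \<longlonglongrightarrow> B $ a $ b"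
            using R by (intro round_to_net_tendsto) auto
          moreover have "(\<lambda>r. (frame e n (x (s r)) *v unit_rep p) $ b) \<longlonglongrightarrow> (?A *v unit_rep p) $ b"
            unfolding frame_mult using lim by (auto intro!: tendsto_intros)
          ultimately show ?thesis
            by (intro tendsto_mult tendsto_const)
        next
          case False
          have "(\<Lambda> *v unit_rep p) $ a = 0" if "k \<le> e a"
            using \<Lambda>[OF that] by (simp add: matrix_vector_mult_def)
          moreover have "(frame e n y *v unit_rep p) $ b = 0" if "n \<le> e b" for y
            using that by (simp add: frame_mult)
          ultimately have "(\<Lambda> *v unit_rep p) $ a = 0 \<or> (\<forall>y. (frame e n y *v unit_rep p) $ b = 0)"
            using False by (auto simp: not_less)
          then show ?thesis
            by auto
        qed
      qed
      show "0 < 1 / real (?R r)" for r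
        by simp
      show "(\<lambda>r. 1 / real (?R r)) \<longlonglongrightarrow> 0"
        using filterlim_compose[OF lim_1_over_n R] .
      have "\<forall>\<^sub>F r in sequentially. \<forall>a b. \<bar>B $ a $ b\<bar> + 1 \<le> real (?R r)"
      proof -
        have "\<forall>\<^sub>F r in sequentially. \<bar>B $ a $ b\<bar> + 1 \<le> real (?R r)" for a b
          using filterlim_compose[OF filterlim_real_sequentially R] unfolding filterlim_at_top by blast
        then show ?thesis
          by (simp add: eventually_all_finite)
      qed
      then show "\<forall>\<^sub>F r in sequentially. ?c \<le> (\<integral>p. ramp (1 / real (?R r)) (?g r p) \<partial>\<mu> j)"
      proof eventually_elim
        case (elim r)
        then show ?case
          by (intro ge[OF j] round_in_net) auto
      qed
    qed
    moreover have "space (\<mu> j) = UNIV"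
      using sets_eq_imp_space_eq[OF borel[OF j]] by simp
    ultimately show ?thesis
      by simp
  qed
  ultimately show ?thesis
    using A_row by blast
qed

section \<open>The two parts cut out by a pair of hyperplanes\<close>

lemma dim_orthogonal_comp:
  fixes S :: "'a::euclidean_space set"
  assumes "subspace S"
  shows "dim (orthogonal_comp S) + dim S = DIM('a)"
  using dim_subspace_orthogonal_to_vectors[OF assms subspace_UNIV] by (simp add: orthogonal_comp_def)

lemma line_subset_kernel_iff: "line_of p \<subseteq> {x. \<eta> \<bullet> x = 0} \<longleftrightarrow> \<eta> \<bullet> unit_rep p = 0"
proof
  assume "\<eta> \<bullet> unit_rep p = 0"
  then show "line_of p \<subseteq> {x. \<eta> \<bullet> x = 0}"
    unfolding line_of_eq_span_unit_rep by (intro span_minimal) (auto intro: subspace_hyperplane)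
qed (use unit_rep_in_line in blast)

text \<open>Every nonzero vector lies on a line of projective space.\<close>

lemma projective_subset_imp_subset:
  assumes "subspace T" "{p. line_of p \<subseteq> S} \<subseteq> {p. line_of p \<subseteq> T}" "subspace S"
  shows "S \<subseteq> T"
proof
  fix x assume x: "x \<in> S"
  show "x \<in> T"
  proof (cases "x = 0")
    case False
    then obtain p where p: "x \<in> line_of p"
      using ex_line_of by blast
    have "line_of p \<subseteq> S"
      unfolding line_of_eq_span[OF p False] using x \<open>subspace S\<close> by (simp add: span_minimal)
    then show ?thesis
      using assms(2) p by blast
  qed (simp add: subspace_0 assms(1))
qed

text \<open>The last property turns containment of projective subspaces into membership in a space of
functionals, for which a spanning matrix can be chosen.\<close>

lemma hyperplane_normal:
  fixes H :: "'n::finite rproj set"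
  assumes "CARD('n) = d + 1" "0 < d" "projective_subspace (d - 1) H" 
  obtains \<eta> where "\<eta> \<noteq> 0" "H = {p. \<eta> \<bullet> unit_rep p = 0}"
    "\<And>S. subspace S \<Longrightarrow> {p. line_of p \<subseteq> S} \<subseteq> H \<Longrightarrow> \<eta> \<in> orthogonal_comp S"
proof -
  obtain S where S: "subspace S" "dim S = d" "H = {p. line_of p \<subseteq> S}"
    using assms unfolding projective_subspace_def by auto
  then obtain \<eta> where \<eta>: "\<eta> \<noteq> 0" "span S \<subseteq> {x. \<eta> \<bullet> x = 0}"
    using lowdim_subset_hyperplane[of S] assms by auto
  have "dim {x. \<eta> \<bullet> x = 0} = d"
    using \<eta>(1) assms by (simp add: dim_hyperplane)
  then have "S = {x. \<eta> \<bullet> x = 0}"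
    using S \<eta>(2) subspace_hyperplane span_superset[of S] by (intro subspace_dim_equal) auto
  then have H: "H = {p. \<eta> \<bullet> unit_rep p = 0}"
    using S(3) line_subset_kernel_iff by auto
  have "\<eta> \<in> orthogonal_comp T" if T: "subspace T" "{p. line_of p \<subseteq> T} \<subseteq> H" for T
  proof -
    have "T \<subseteq> S"
      using projective_subset_imp_subset[OF S(1) T(2)[unfolded S(3)] T(1)] .
    then have "x \<bullet> \<eta> = 0" if "x \<in> T" for x
      using that \<open>S = {x. \<eta> \<bullet> x = 0}\<close> by (subst inner_commute) blast
    then show ?thesis
      by (simp add: orthogonal_comp_def orthogonal_def)
  qed
  with \<eta>(1) H show ?thesis
    by (rule that)
qed

definition proj :: "real ^ 'n::finite \<Rightarrow> 'n rproj" where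
  "proj x = (SOME p. x \<in> line_of p)"

lemma in_line_proj: "x \<noteq> 0 \<Longrightarrow> x \<in> line_of (proj x)"
  unfolding proj_def by (rule someI_ex[OF ex_line_of])

lemma proj_eqI: "x \<in> line_of p \<Longrightarrow> x \<noteq> 0 \<Longrightarrow> proj x = p"
  using line_of_unique in_line_proj by blast

lemma proj_vimage: "proj -` U \<inter> - {0} = {x. x \<noteq> 0 \<and> (\<exists>p\<in>U. x \<in> line_of p)}"
  using in_line_proj proj_eqI by auto

lemma continuous_on_proj: "continuous_on (- {0}) (proj :: real ^ 'n::finite \<Rightarrow> _)"
  unfolding continuous_on_open_vimage[OF open_Compl[OF closed_singleton]] proj_vimage
  by (simp add: open_rproj_def)

lemma unit_rep_nonzero: "unit_rep p \<noteq> 0"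
  using norm_unit_rep[of p] by auto

lemma proj_unit_rep: "proj (unit_rep p) = p" and proj_minus_unit_rep: "proj (- unit_rep p) = p"
proof -
  show "proj (unit_rep p) = p"
    by (intro proj_eqI unit_rep_in_line unit_rep_nonzero)
  have "- unit_rep p \<in> line_of p"
    by (intro subspace_neg subspace_line_of unit_rep_in_line)
  then show "proj (- unit_rep p) = p"
    by (rule proj_eqI) (simp add: unit_rep_nonzero)
qed

lemma unit_rep_proj:
  assumes "x \<noteq> 0"
  obtains c where "c \<noteq> 0" "unit_rep (proj x) = c *\<^sub>R x"
proof -
  have "unit_rep (proj x) \<in> span {x}"
    using line_of_eq_span[OF in_line_proj[OF assms] assms] unit_rep_in_line by metis
  then obtain c where "unit_rep (proj x) = c *\<^sub>R x"
    by (auto simp: span_singleton)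
  moreover from this have "c \<noteq> 0"
    using norm_unit_rep[of "proj x"] by auto
  ultimately show ?thesis
    using that by blast
qed

text \<open>Only the sign of this value is independent of the choice of a vector on the line.\<close>

definition form2 :: "real ^ 'n \<Rightarrow> real ^ 'n \<Rightarrow> 'n::finite rproj \<Rightarrow> real" where
  "form2 l \<eta> p = (l \<bullet> unit_rep p) * (\<eta> \<bullet> unit_rep p)"

lemma continuous_on_form2: "continuous_on UNIV (form2 l \<eta>)"
  unfolding form2_def[abs_def] by (rule continuous_on_even_unit_rep) (auto intro!: continuous_intros)

lemma form2_proj_pos:
  assumes "x \<noteq> 0"
  shows "0 < form2 l \<eta> (proj x) \<longleftrightarrow> 0 < (l \<bullet> x) * (\<eta> \<bullet> x)"
proof -
  obtain c where c: "c \<noteq> 0" "unit_rep (proj x) = c *\<^sub>R x"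
    using unit_rep_proj[OF assms] .
  then have "form2 l \<eta> (proj x) = c\<^sup>2 * ((l \<bullet> x) * (\<eta> \<bullet> x))"
    by (simp add: form2_def power2_eq_square)
  then show ?thesis
    using c(1) by (simp add: zero_less_mult_iff)
qed

text \<open>One of the two unit vectors on the line lies in the open convex cone where both functionals are positive.\<close>

lemma form2_pos_eq_image: "{p. 0 < form2 l \<eta> p} = proj ` {x. 0 < l \<bullet> x \<and> 0 < \<eta> \<bullet> x}"
proof (intro equalityI subsetI)
  fix p assume "p \<in> {p. 0 < form2 l \<eta> p}"
  then have "unit_rep p \<in> {x. 0 < l \<bullet> x \<and> 0 < \<eta> \<bullet> x} \<or> - unit_rep p \<in> {x. 0 < l \<bullet> x \<and> 0 < \<eta> \<bullet> x}"
    by (auto simp: form2_def zero_less_mult_iff)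
  then show "p \<in> proj ` {x. 0 < l \<bullet> x \<and> 0 < \<eta> \<bullet> x}"
    using imageI[of "unit_rep p" _ proj] imageI[of "- unit_rep p" _ proj] unfolding proj_unit_rep proj_minus_unit_rep by blast
next
  fix p assume "p \<in> proj ` {x. 0 < l \<bullet> x \<and> 0 < \<eta> \<bullet> x}"
  then obtain x where x: "p = proj x" "0 < l \<bullet> x" "0 < \<eta> \<bullet> x"
    by auto
  then have "x \<noteq> 0" by auto
  then show "p \<in> {p. 0 < form2 l \<eta> p}"
    using x form2_proj_pos[of x] by simp
qed

lemma connected_form2_pos: "connected {p. 0 < form2 l \<eta> p}"
proof -
  have "convex ({x. 0 < l \<bullet> x} \<inter> {x. 0 < \<eta> \<bullet> x})"
    using convex_halfspace_gt[of 0] by (intro convex_Int) auto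
  then have "connected {x. 0 < l \<bullet> x \<and> 0 < \<eta> \<bullet> x}"
    by (simp add: convex_connected Collect_conj_eq)
  moreover have "continuous_on {x. 0 < l \<bullet> x \<and> 0 < \<eta> \<bullet> x} proj"
    by (rule continuous_on_subset[OF continuous_on_proj]) auto
  ultimately show ?thesis
    unfolding form2_pos_eq_image by (rule connected_continuous_image[rotated])
qed

lemma open_form2_pos: "open {p. 0 < form2 l \<eta> p}"
  using continuous_on_form2 by (intro open_Collect_less continuous_on_const)

lemma closed_form2_nonneg: "closed {p. 0 \<le> form2 l \<eta> p}"
  using continuous_on_form2 by (intro closed_Collect_le continuous_on_const)

lemma form2_minus: "form2 l (- \<eta>) p = - form2 l \<eta> p"
  by (simp add: form2_def)

text \<open>A boundary point is moved into the open part along a direction \<open>z\<close> on which both functionals are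
positive.\<close>

lemma closure_form2_pos:
  assumes z: "0 < l \<bullet> z" "0 < \<eta> \<bullet> z"
  shows "closure {p. 0 < form2 l \<eta> p} = {p. 0 \<le> form2 l \<eta> p}" 
proof (rule antisym)
  show "closure {p. 0 < form2 l \<eta> p} \<subseteq> {p. 0 \<le> form2 l \<eta> p}"
    by (rule closure_minimal) (auto intro: closed_form2_nonneg)
next
  show "{p. 0 \<le> form2 l \<eta> p} \<subseteq> closure {p. 0 < form2 l \<eta> p}"
  proof
    fix p assume p: "p \<in> {p. 0 \<le> form2 l \<eta> p}"
    obtain x where x: "proj x = p" "x \<noteq> 0" "0 \<le> l \<bullet> x" "0 \<le> \<eta> \<bullet> x"
    proof -
      have "(0 \<le> l \<bullet> unit_rep p \<and> 0 \<le> \<eta> \<bullet> unit_rep p) \<or> (0 \<le> l \<bullet> (- unit_rep p) \<and> 0 \<le> \<eta> \<bullet> (- unit_rep p))"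
        using p by (auto simp: form2_def zero_le_mult_iff)
      then show ?thesis
        using that[OF proj_unit_rep] that[OF proj_minus_unit_rep] unit_rep_nonzero[of p] by auto
    qed
    show "p \<in> closure {p. 0 < form2 l \<eta> p}"
      unfolding closure_interior
    proof (intro ComplI)
      assume "p \<in> interior (- {p. 0 < form2 l \<eta> p})"
      then obtain T where T: "open T" "p \<in> T" "T \<subseteq> - {p. 0 < form2 l \<eta> p}"
        unfolding interior_def by blast
      have "open (proj -` T \<inter> - {0})"
        using T(1) by (simp add: proj_vimage open_rproj_def)
      moreover have "x \<in> proj -` T \<inter> - {0}"
        using x T by simp
      ultimately obtain \<epsilon> where \<epsilon>: "0 < \<epsilon>" "ball x \<epsilon> \<subseteq> proj -` T \<inter> - {0}"
        unfolding open_contains_ball by blast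
      define t where "t = \<epsilon> / (2 * (norm z + 1))"
      have arith: "0 < 2 * (s + 1)" "s < 2 * (s + 1)" if "0 \<le> s" for s :: real
        using that by simp_all
      have pos: "0 < 2 * (norm z + 1)"
        by (rule arith) simp
      have "t > 0"
        unfolding t_def using \<epsilon>(1) pos by (rule divide_pos_pos)
      have "\<epsilon> * norm z < \<epsilon> * (2 * (norm z + 1))"
        using \<epsilon>(1) by (intro mult_strict_left_mono arith norm_ge_zero)
      then have "t * norm z < \<epsilon>"
        using pos by (simp only: t_def times_divide_eq_left pos_divide_less_eq)
      then have y: "x + t *\<^sub>R z \<in> proj -` T \<inter> - {0}"
        using \<open>t > 0\<close> by (intro subsetD[OF \<epsilon>(2)]) (simp add: dist_norm)
      have "0 < l \<bullet> x + t * (l \<bullet> z)" "0 < \<eta> \<bullet> x + t * (\<eta> \<bullet> z)"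
        using x(3,4) z \<open>t > 0\<close> by (simp_all add: add_nonneg_pos)
      then have "0 < (l \<bullet> (x + t *\<^sub>R z)) * (\<eta> \<bullet> (x + t *\<^sub>R z))"
        by (simp add: inner_add_right)
      then have "0 < form2 l \<eta> (proj (x + t *\<^sub>R z))"
        using y by (subst form2_proj_pos) auto
      then show False
        using y T(3) by auto
    qed
  qed
qed

lemma components_Un_open:
  assumes "open A" "open B" "A \<inter> B = {}" "connected A" "connected B" "A \<noteq> {}" "B \<noteq> {}"
  shows "components (A \<union> B) = {A, B}"
proof -
  have sub: "D \<subseteq> A \<or> D \<subseteq> B" if "connected D" "D \<subseteq> A \<union> B" for D
    using connectedD[OF that(1) assms(1,2)] that(2) assms(3) by blast
  have A: "D = A" if "connected D" "A \<subseteq> D" "D \<subseteq> A \<union> B" for D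
    using sub[OF that(1,3)] that(2) assms(3,6) by blast
  have B: "D = B" if "connected D" "B \<subseteq> D" "D \<subseteq> A \<union> B" for D
    using sub[OF that(1,3)] that(2) assms(3,7) by blast
  have "A \<in> components (A \<union> B)"
    unfolding in_components_maximal
  proof (intro conjI allI impI)
    fix D assume "D \<noteq> {} \<and> A \<subseteq> D \<and> D \<subseteq> A \<union> B \<and> connected D"
    then show "D = A"
      by (intro A) simp_all
  qed (use assms in auto)
  moreover have "B \<in> components (A \<union> B)"
    unfolding in_components_maximal
  proof (intro conjI allI impI)
    fix D assume "D \<noteq> {} \<and> B \<subseteq> D \<and> D \<subseteq> A \<union> B \<and> connected D"
    then show "D = B"
      by (intro B) simp_all
  qed (use assms in auto)
  moreover have "C = A \<or> C = B" if C: "C \<in> components (A \<union> B)" for C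
  proof -
    have max: "D = C" if "D \<noteq> {}" "C \<subseteq> D" "D \<subseteq> A \<union> B" "connected D" for D
      using C that unfolding in_components_maximal by simp
    have "C \<subseteq> A \<or> C \<subseteq> B"
      by (intro sub in_components_connected[OF C] in_components_subset[OF C])
    then show ?thesis
      using max[of A] max[of B] assms(4-7) by blast
  qed
  ultimately show ?thesis
    by blast
qed

text \<open>If the functionals are proportional, the hyperplanes are equal, and one part is the whole space
while the other one is the hyperplane. Otherwise the sets where the product is positive or negative are images of
nonempty convex cones, hence connected.\<close>

lemma hyperplane_parts_form2:
  fixes l \<eta> :: "real ^ 'n::finite"
  assumes "l \<noteq> 0" "\<eta> \<noteq> 0"
  defines "P \<equiv> {p. 0 \<le> form2 l \<eta> p}" and "N \<equiv> {p. form2 l \<eta> p \<le> 0}"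
  shows "P \<noteq> N" and "hyperplane_parts {p. l \<bullet> unit_rep p = 0} {p. \<eta> \<bullet> unit_rep p = 0} = {P, N}"
proof -
  let ?H1 = "{p. l \<bullet> unit_rep p = 0}" and ?H2 = "{p. \<eta> \<bullet> unit_rep p = 0}"
  have "P \<noteq> N \<and> hyperplane_parts ?H1 ?H2 = {P, N}"
  proof (cases "\<exists>c. \<eta> = c *\<^sub>R l")
    case True
    then obtain c where c: "\<eta> = c *\<^sub>R l" "c \<noteq> 0"
      using assms by auto
    have form: "form2 l \<eta> p = c * (l \<bullet> unit_rep p)\<^sup>2" for p
      by (simp add: form2_def c power2_eq_square)
    have "proj l \<notin> ?H1"
    proof -
      obtain b where "b \<noteq> 0" "unit_rep (proj l) = b *\<^sub>R l"
        using unit_rep_proj[OF assms(1)] .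
      then show ?thesis
        using assms(1) by simp
    qed
    then have "?H1 \<noteq> UNIV"
      by blast
    moreover have "?H1 = ?H2"
      using c by simp
    moreover have "P = UNIV \<and> N = ?H1 \<or> N = UNIV \<and> P = ?H1"
      using c(2) unfolding P_def N_def form
      by (cases "c > 0") (auto simp: zero_le_mult_iff mult_le_0_iff)
    ultimately show ?thesis
      unfolding hyperplane_parts_def by auto
  next
    case False
    have proj_off: "\<exists>x. u \<bullet> x = 0 \<and> 0 < v \<bullet> x" if "u \<noteq> 0" "\<nexists>c. v = c *\<^sub>R u" for u v :: "real ^ 'n"
    proof -
      let ?x = "v - ((v \<bullet> u) / (u \<bullet> u)) *\<^sub>R u"
      have ux: "u \<bullet> ?x = 0"
        using that(1) by (simp add: inner_diff_right inner_commute)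
      have "?x \<noteq> 0"
        using that(2) by auto
      then have "0 < ?x \<bullet> ?x"
        by simp
      also have "?x \<bullet> ?x = v \<bullet> ?x"
        using ux by (simp add: inner_diff_left)
      finally show ?thesis
        using ux by blast
    qed
    obtain x where x: "l \<bullet> x = 0" "0 < \<eta> \<bullet> x"
      using proj_off[OF assms(1) False] by blast
    have "\<nexists>c. l = c *\<^sub>R \<eta>"
      using False assms(1) by (metis divideR_right scale_eq_0_iff)
    then obtain y where y: "\<eta> \<bullet> y = 0" "0 < l \<bullet> y"
      using proj_off[OF assms(2)] by blast
    have z: "0 < l \<bullet> (y + x)" "0 < \<eta> \<bullet> (y + x)"
      and z': "0 < l \<bullet> (y - x)" "0 < (- \<eta>) \<bullet> (y - x)"
      using x y by (auto simp: inner_add_right inner_diff_right)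
    define A where "A = {p. 0 < form2 l \<eta> p}"
    define B where "B = {p. 0 < form2 l (- \<eta>) p}"
    have clA: "closure A = P"
      unfolding A_def P_def by (rule closure_form2_pos[OF z])
    have "closure B = {p. 0 \<le> form2 l (- \<eta>) p}"
      unfolding B_def by (rule closure_form2_pos[OF z'])
    then have clB: "closure B = N"
      by (simp add: N_def form2_minus)
    have ne: "A \<noteq> {}" "B \<noteq> {}"
      unfolding A_def B_def form2_pos_eq_image using z z' by blast+
    have disj: "A \<inter> B = {}"
      by (auto simp: A_def B_def form2_minus)
    have "components (A \<union> B) = {A, B}"
      using ne disj unfolding A_def B_def
      by (intro components_Un_open open_form2_pos connected_form2_pos) auto
    moreover have "UNIV - (?H1 \<union> ?H2) = A \<union> B"
      by (auto simp: A_def B_def form2_minus form2_def zero_less_mult_iff mult_less_0_iff)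
    ultimately have comp: "closure ` components (UNIV - (?H1 \<union> ?H2)) = {P, N}"
      using clA clB by simp
    obtain a where "a \<in> A"
      using ne by blast
    then have "a \<in> P" "a \<notin> N"
      by (auto simp: A_def P_def N_def)
    then have PN: "P \<noteq> N"
      by blast
    have "?H1 \<noteq> ?H2"
    proof
      assume H: "?H1 = ?H2"
      have "x \<noteq> 0"
        using x by auto
      then obtain c where c: "c \<noteq> 0" "unit_rep (proj x) = c *\<^sub>R x"
        using unit_rep_proj by blast
      have "proj x \<in> ?H1"
        using x c by simp
      then have "proj x \<in> ?H2"
        using H by blast
      then show False
        using x c by simp
    qed
    then show ?thesis
      using comp PN by (simp add: hyperplane_parts_def)
  qed
  then show "P \<noteq> N" "hyperplane_parts ?H1 ?H2 = {P, N}"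
    by auto
qed

section \<open>The projective center transversal theorem\<close>

text \<open>A linear combination of rows is a functional of the image \<open>A *v x\<close>.\<close>

lemma span_rows_functional:
  fixes A :: "real ^ 'n ^ 'n::finite"
  assumes "u \<in> span (range (($) A))"
  shows "\<exists>b. \<forall>x. b \<bullet> (A *v x) = u \<bullet> x"
  using assms
proof (induction rule: span_induct)
  case base
  show ?case
    unfolding subspace_def mem_Collect_eq
  proof (intro conjI allI ballI impI)
    show "\<exists>b. \<forall>x. b \<bullet> (A *v x) = 0 \<bullet> x"
      by (intro exI[of _ 0]) simp
  next
    fix u v assume "u \<in> {u. \<exists>b. \<forall>x. b \<bullet> (A *v x) = u \<bullet> x}" "v \<in> {u. \<exists>b. \<forall>x. b \<bullet> (A *v x) = u \<bullet> x}"
    then obtain b c where "\<And>x. b \<bullet> (A *v x) = u \<bullet> x" "\<And>x. c \<bullet> (A *v x) = v \<bullet> x"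
      by auto
    then show "\<exists>b. \<forall>x. b \<bullet> (A *v x) = (u + v) \<bullet> x"
      by (intro exI[of _ "b + c"]) (simp add: inner_add_left)
  next
    fix r u assume "u \<in> {u. \<exists>b. \<forall>x. b \<bullet> (A *v x) = u \<bullet> x}"
    then obtain b where "\<And>x. b \<bullet> (A *v x) = u \<bullet> x"
      by auto
    then show "\<exists>b. \<forall>x. b \<bullet> (A *v x) = (r *\<^sub>R u) \<bullet> x"
      by (intro exI[of _ "r *\<^sub>R b"]) simp
  qed
next
  case (step u)
  then obtain a where "u = A $ a"
    by auto
  then show ?case
    by (intro exI[of _ "axis a 1"]) (simp add: inner_axis' matrix_vector_mul_component)
qed

text \<open>With \<open>l = b\<^sup>T \<Lambda>\<close> and \<open>\<eta> = c\<^sup>T A\<close>, the matrix \<open>B\<close> is \<open>b c\<^sup>T\<close>.\<close>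

lemma form2_eq_inner_outer:
  assumes "l \<in> span (range (($) \<Lambda>))" "\<eta> \<in> span (range (($) A))"
  obtains B where "\<And>p. outer \<Lambda> A (unit_rep p) \<bullet> B = form2 l \<eta> p"
proof -
  obtain b c where b: "\<And>x. b \<bullet> (\<Lambda> *v x) = l \<bullet> x" and c: "\<And>x. c \<bullet> (A *v x) = \<eta> \<bullet> x"
    using span_rows_functional assms by metis
  have "outer \<Lambda> A (unit_rep p) \<bullet> (\<chi> i j. b $ i * c $ j) = (b \<bullet> (\<Lambda> *v unit_rep p)) * (c \<bullet> (A *v unit_rep p))" for p
    unfolding inner_outer unfolding inner_vec_def inner_real_def sum_product
    by (intro sum.cong refl) simp
  then show ?thesis
    using that b c unfolding form2_def by auto
qed

lemma dim_span_orthogonal_rows: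
  fixes A :: "real ^ 'n ^ 'n::finite"
  assumes "bij_betw e UNIV {..<CARD('n)}" "n \<le> CARD('n)"
    and zero: "\<And>a. n \<le> e a \<Longrightarrow> A $ a = 0" and nz: "\<And>a. e a < n \<Longrightarrow> A $ a \<noteq> 0"
    and orth: "\<And>a b. a \<noteq> b \<Longrightarrow> A $ a \<bullet> A $ b = 0"
  shows "dim (span (range (($) A))) = n"
proof -
  let ?I = "{a. e a < n}"
  let ?R = "($) A ` ?I"
  have inj: "inj_on (($) A) ?I"
    using orth nz by (intro inj_onI) (metis inner_eq_zero_iff mem_Collect_eq)
  have "e ` ?I = {..<n}"
  proof -
    have "{..<n} \<subseteq> e ` UNIV"
      using assms(1,2) by (auto simp: bij_betw_def)
    then show ?thesis
      by auto
  qed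
  then have "card ?I = n"
    using bij_betw_imp_inj_on[OF assms(1)] by (metis card_image card_lessThan inj_on_subset subset_UNIV)
  moreover have "independent ?R"
    using nz by (intro pairwise_orthogonal_independent) (auto simp: pairwise_def orthogonal_def intro!: orth)
  moreover have "span (range (($) A)) = span ?R"
  proof (rule antisym)
    have "A $ a \<in> span ?R" for a
      using zero[of a] by (cases "e a < n") (auto intro: span_base simp: span_zero)
    then show "span (range (($) A)) \<subseteq> span ?R"
      by (intro span_minimal) auto
  qed (intro span_mono, auto)
  ultimately show ?thesis
    by (simp add: dim_eq_card_independent card_image[OF inj])
qed

lemma matrix_with_row_space:
  fixes S :: "(real ^ 'n::finite) set"
  assumes e: "bij_betw e UNIV {..<CARD('n)}" and "subspace S"
  obtains A :: "real ^ 'n ^ 'n" where "S \<subseteq> span (range (($) A))" "\<And>a. dim S \<le> e a \<Longrightarrow> A $ a = 0"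
proof -
  obtain B where B: "B \<subseteq> S" "independent B" "S \<subseteq> span B" "card B = dim S"
    using basis_exists by blast
  obtain h where h: "bij_betw h {0..<card B} B"
    using ex_bij_betw_nat_finite[OF independent_imp_finite[OF B(2)]] by blast
  define A where "A = (\<chi> a. if e a < dim S then h (e a) else (0 :: real ^ 'n))"
  have "B \<subseteq> range (($) A)"
  proof
    fix u assume "u \<in> B"
    then obtain l where l: "l < dim S" "u = h l"
      using h B(4) by (auto simp: bij_betw_def)
    have "l \<in> e ` UNIV"
      using e l(1) dim_subset_UNIV[of S] by (auto simp: bij_betw_def)
    then obtain a where "l = e a"
      by blast
    then show "u \<in> range (($) A)"
      using l by (intro image_eqI[of _ _ a]) (auto simp: A_def)
  qed
  then have "S \<subseteq> span (range (($) A))"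
    using B(3) span_mono by blast
  moreover have "A $ a = 0" if "dim S \<le> e a" for a
    using that by (simp add: A_def)
  ultimately show ?thesis
    by (rule that)
qed

theorem corollary5p1:
  fixes d v m w D :: nat
    and \<mu> :: "nat \<Rightarrow> 'n::finite rproj measure"
    and V :: "'n rproj set"
  assumes dim: "CARD('n) = d + 1"
    and v: "v < d"
    and m: "m \<ge> 1"
    and w: "w = m * (d - v) - 1"
    and wd: "w < d"
    and D: "D = (d - v) * (d - w)"
    and prob: "\<And>j. j \<in> {1..m} \<Longrightarrow> prob_space (\<mu> j)"
    and borel: "\<And>j. j \<in> {1..m} \<Longrightarrow> sets (\<mu> j) = sets borel"
    and V: "projective_subspace v V"
  shows "\<exists>W :: 'n rproj set. projective_subspace w W \<and>
    (\<forall>H1 H2. projective_subspace (d - 1) H1 \<and> V \<subseteq> H1 \<and>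
        projective_subspace (d - 1) H2 \<and> W \<subseteq> H2 \<longrightarrow>
      (\<exists>P1 P2. P1 \<noteq> P2 \<and> hyperplane_parts H1 H2 = {P1, P2} \<and> closed P1 \<and> closed P2 \<and>
        (\<forall>j\<in>{1..m}. measure (\<mu> j) P1 \<ge> 1 / (real D + 1) \<and>
                     measure (\<mu> j) P2 \<ge> 1 / (real D + 1))))"
proof -
  let ?k = "d - v" and ?n = "d - w" and ?c = "1 / (real D + 1)"
  have "m * ?k \<ge> 1"
    using m v by simp
  then have w1: "w + 1 = m * ?k"
    using w by linarith
  then have card: "CARD('n) = m * ?k + ?n"
    using dim wd by simp
  obtain e :: "'n \<Rightarrow> nat" where e: "bij_betw e UNIV {..<CARD('n)}"
    using ex_bij_betw_finite_nat[OF finite, of "UNIV :: 'n set"] by (auto simp: atLeast0LessThan)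
  obtain SV where SV: "subspace SV" "dim SV = v + 1" "V = {p. line_of p \<subseteq> SV}"
    using V unfolding projective_subspace_def by blast
  have dimV: "dim (orthogonal_comp SV) = ?k"
    using dim_orthogonal_comp[OF SV(1)] SV(2) dim by simp
  obtain \<Lambda> :: "real ^ 'n ^ 'n" where \<Lambda>: "orthogonal_comp SV \<subseteq> span (range (($) \<Lambda>))"
    "\<And>a. ?k \<le> e a \<Longrightarrow> \<Lambda> $ a = 0"
    using matrix_with_row_space[OF e subspace_orthogonal_comp[of SV]] unfolding dimV by blast
  have "prob_space (\<mu> (Suc j))" "sets (\<mu> (Suc j)) = sets borel" if "j < m" for j
    using prob[of "Suc j"] borel[of "Suc j"] that by auto
  then obtain A :: "real ^ 'n ^ 'n" where A: "\<forall>a. ?n \<le> e a \<longrightarrow> A $ a = 0" "\<forall>a. e a < ?n \<longrightarrow> A $ a \<noteq> 0"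
    "\<forall>a b. a \<noteq> b \<longrightarrow> A $ a \<bullet> A $ b = 0"
    and center: "\<forall>j<m. \<forall>B. 1 / (real (?k * ?n) + 1) \<le> measure (\<mu> (Suc j)) {p. outer \<Lambda> A (unit_rep p) \<bullet> B \<ge> 0}"
    using central_frame[OF e card \<Lambda>(2), of "\<lambda>j. \<mu> (Suc j)"] by blast
  let ?U = "span (range (($) A))"
  \<comment> \<open>The subspace sought is the common kernel of the rows of the central frame.\<close>
  let ?SW = "orthogonal_comp ?U"
  let ?W = "{p. line_of p \<subseteq> ?SW}"
  have "dim ?U = ?n"
    using card by (intro dim_span_orthogonal_rows[OF e]) (use A in auto)
  then have "dim ?SW = w + 1"
    using dim_orthogonal_comp[OF subspace_span, of "range (($) A)"] card w1 by simp
  then have W: "projective_subspace w ?W"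
    unfolding projective_subspace_def by (intro exI[of _ ?SW]) (simp add: subspace_orthogonal_comp)
  have parts: "\<exists>P1 P2. P1 \<noteq> P2 \<and> hyperplane_parts H1 H2 = {P1, P2} \<and> closed P1 \<and> closed P2 \<and>
        (\<forall>j\<in>{1..m}. measure (\<mu> j) P1 \<ge> ?c \<and> measure (\<mu> j) P2 \<ge> ?c)"
    if H1: "projective_subspace (d - 1) H1" "V \<subseteq> H1" and H2: "projective_subspace (d - 1) H2" "?W \<subseteq> H2" for H1 H2
  proof -
    have "0 < d"
      using v by simp
    obtain l where l: "l \<noteq> 0" "H1 = {p. l \<bullet> unit_rep p = 0}" "l \<in> orthogonal_comp SV"
      using hyperplane_normal[OF dim \<open>0 < d\<close> H1(1)] SV H1(2) by metis
    obtain \<eta> where \<eta>: "\<eta> \<noteq> 0" "H2 = {p. \<eta> \<bullet> unit_rep p = 0}" "\<eta> \<in> orthogonal_comp ?SW"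
      using hyperplane_normal[OF dim \<open>0 < d\<close> H2(1)] H2(2) subspace_orthogonal_comp by metis
    have "\<eta> \<in> ?U"
      using \<eta>(3) orthogonal_comp_self[OF subspace_span] by blast
    moreover have "l \<in> span (range (($) \<Lambda>))"
      using l(3) \<Lambda>(1) by blast
    ultimately obtain B where B: "\<And>p. outer \<Lambda> A (unit_rep p) \<bullet> B = form2 l \<eta> p"
      using form2_eq_inner_outer by metis
    let ?P = "{p. 0 \<le> form2 l \<eta> p}" and ?N = "{p. form2 l \<eta> p \<le> 0}"
    have ge: "?c \<le> measure (\<mu> j) ?P \<and> ?c \<le> measure (\<mu> j) ?N" if "j \<in> {1..m}" for j
    proof -
      obtain i where i: "j = Suc i" "i < m"
        using \<open>j \<in> {1..m}\<close> by (cases j) auto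
      show ?thesis
        \<comment> \<open>The other part belongs to the opposite direction.\<close>
        using center[rule_format, OF i(2), of B] center[rule_format, OF i(2), of "- B"] i(1) by (simp add: B D)
    qed
    have "?P \<noteq> ?N" "hyperplane_parts H1 H2 = {?P, ?N}"
      unfolding l(2) \<eta>(2) by (rule hyperplane_parts_form2[OF l(1) \<eta>(1)])+
    moreover have "closed ?P"
      by (rule closed_form2_nonneg)
    moreover have "closed ?N"
      using closed_form2_nonneg[of l "- \<eta>"] by (simp add: form2_minus)
    ultimately show ?thesis
      by (intro exI[of _ ?P] exI[of _ ?N] conjI ballI) (simp_all add: ge)
  qed
  show ?thesis
  proof (rule exI[of _ ?W], intro conjI allI impI W)
    fix H1 H2
    assume "projective_subspace (d - 1) H1 \<and> V \<subseteq> H1 \<and> projective_subspace (d - 1) H2 \<and> ?W \<subseteq> H2"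
    then show "\<exists>P1 P2. P1 \<noteq> P2 \<and> hyperplane_parts H1 H2 = {P1, P2} \<and> closed P1 \<and> closed P2 \<and>
        (\<forall>j\<in>{1..m}. measure (\<mu> j) P1 \<ge> ?c \<and> measure (\<mu> j) P2 \<ge> ?c)"
      by (elim conjE) (rule parts)
  qed
qed

end
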